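(* Let $\varphi:HG\to\mathbb{R}^{3}$ be a spatial embedding of the Heawood graph $HG$ that is a lift of a plane generic immersion $f:HG\to\mathbb{R}^{2}$, and let $D$ be a diagram of $\varphi$ based on $f(HG)$. Set \[ \mathcal{L}(\varphi)=\sum_{(d,e)\in D_{1}(HG)\cup D_{2}(HG)}\varepsilon(d,e)\,\ell_{D}(d,e), \] where $\varepsilon$ and $\ell_D$ are the functions defined in the context. Then \[ \mathcal{L}(\varphi)\equiv\sum_{(d,e)\in D_{2}(HG)}|f(d)\cap f(e)|\equiv 1\pmod 2. \]
   Context: The Heawood graph $HG$ has vertices $u_i,v_i$ ($i\in\mathbb{Z}/7\mathbb{Z}$) and the $21$ edges $u_iv_i$, $u_iv_{i-1}$, $v_iu_{i-2}$, each oriented from the first written vertex to the second. A graph is regarded as a topological space. A plane generic immersion of a graph $G$ is an immersion $f:G\to\mathbb{R}^2$ (a continuous locally injective, piecewise smooth map) whose multiple points are only finitely many transversal double points (crossings) between edges, i.e. between interior points of edges (possibly of the same edge). A spatial embedding of $G$ is an embedding $\varphi:G\to\mathbb{R}^3$. With $\pi(x,y,z)=(x,y)$, $\varphi$ is a lift of $f$ if $f=\pi\circ\varphi$; the diagram $D$ of $\varphi$ based on $f(G)$ is $f(G)$ together with the vertex information $f|_{V(G)}$ and the over/under information of $\varphi$ at each crossing. The distance of two edges is the minimum number of edges of a path joining them; $D_k(HG)$ is the set of unordered pairs $(d,e)$ of edges of $HG$ at distance $k$. For distinct oriented edges $d,e$, $\ell_D(d,e)=c_D^{+}(d,e)-c_D^{-}(d,e)$,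 where $c_D^{\pm}(d,e)$ is the number of positive/negative crossings (with the usual sign convention of knot theory for oriented strands) in $f(d)\cap f(e)$. The map $\varepsilon:D_1(HG)\cup D_2(HG)\to\mathbb{Z}$ is given, for all $i\in\mathbb{Z}/7\mathbb{Z}$, by: $\varepsilon(u_{i}v_{i},u_{i\pm1}v_{i\pm1})=2$; $\varepsilon(u_{i}v_{i},u_{i\pm2}v_{i\pm2})=-2$; $\varepsilon(u_{i}v_{i},u_{i\pm3}v_{i\pm3})=-3$; $\varepsilon(u_{i}v_{i},u_{i+2}v_{i+1})=\varepsilon(u_{i}v_{i},u_{i-1}v_{i-2})=1$; $\varepsilon(u_{i}v_{i},u_{i+3}v_{i+2})=\varepsilon(u_{i}v_{i},u_{i-2}v_{i-3})=2$; $\varepsilon(u_{i}v_{i},u_{i+4}v_{i+3})=5$; $\varepsilon(u_{i}v_{i},v_{i+1}u_{i-1})=3$; $\varepsilon(u_{i}v_{i},v_{i+3}u_{i+1})=\varepsilon(u_{i}v_{i},v_{i-1}u_{i+4})=2$; $\varepsilon(u_{i}v_{i},v_{i+4}u_{i+2})=\varepsilon(u_{i}v_{i},v_{i+5}u_{i+3})=-1$; $\varepsilon(u_{i}v_{i-1},u_{i+1}v_{i})=\varepsilon(u_{i}v_{i-1},u_{i-1}v_{i-2})=2$; $\varepsilon(u_{i}v_{i-1},u_{i+2}v_{i+1})=\varepsilon(u_{i}v_{i-1},u_{i-2}v_{i-3})=1$; $\varepsilon(u_{i}v_{i-1},u_{i+3}v_{i+2})=\varepsilon(u_{i}v_{i-1},u_{i-3}v_{i-4})=-2$;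 $\varepsilon(u_{i}v_{i-1},v_{i}u_{i-2})=\varepsilon(u_{i}v_{i-1},v_{i+1}u_{i-1})=2$; $\varepsilon(u_{i}v_{i-1},v_{i+3}u_{i+1})=\varepsilon(u_{i}v_{i-1},v_{i+5}u_{i+3})=3$; $\varepsilon(u_{i}v_{i-1},v_{i+4}u_{i+2})=3$; $\varepsilon(v_{i}u_{i-2},v_{i+1}u_{i-1})=\varepsilon(v_{i}u_{i-2},v_{i-1}u_{i-3})=5$; $\varepsilon(v_{i}u_{i-2},v_{i+2}u_{i})=\varepsilon(v_{i}u_{i-2},v_{i-2}u_{i-4})=2$; $\varepsilon(v_{i}u_{i-2},v_{i+3}u_{i+1})=\varepsilon(v_{i}u_{i-2},v_{i-3}u_{i-5})=2$. *)

theory Defs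
  imports "HOL-Analysis.Analysis" "HOL-Number_Theory.Cong"
begin

section \<open>The Heawood graph\<close>

text \<open>The type \<open>7\<close> of HOL-Library.Numeral_Type is the ring of integers modulo 7.\<close>

datatype vertex = U 7 | V 7

lemma UNIV_vertex: "UNIV = range U \<union> range V"
proof -
  have "x \<in> range U \<union> range V" for x by (cases x) auto
  then show ?thesis by blast
qed

instance vertex :: finite
  by standard (simp add: UNIV_vertex)

type_synonym edge = "vertex \<times> vertex"  \<comment> \<open>(tail, head)\<close>

definition edges :: "edge set" where
  "edges = (\<Union>i. {(U i, V i), (U i, V (i - 1)), (V i, U (i - 2))})"

definition adjacent :: "vertex \<Rightarrow> vertex \<Rightarrow> bool" where
  "adjacent x y \<longleftrightarrow> (x, y) \<in> edges \<or> (y, x) \<in> edges"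

definition ends :: "edge \<Rightarrow> vertex set" where
  "ends d = {fst d, snd d}"

definition graph_path :: "vertex list \<Rightarrow> bool" where
  "graph_path xs \<longleftrightarrow> xs \<noteq> [] \<and> distinct xs \<and> successively adjacent xs"

text \<open>A path with vertex list \<open>xs\<close> has \<open>length xs - 1\<close> edges.\<close>

definition edge_dist :: "edge \<Rightarrow> edge \<Rightarrow> nat" where
  "edge_dist d e = (LEAST n. \<exists>xs. graph_path xs \<and> hd xs \<in> ends d \<and> last xs \<in> ends e
                               \<and> n = length xs - 1)"

text \<open>Unordered pairs of distinct edges are represented by two-element sets.\<close>

definition edge_pairs :: "nat \<Rightarrow> edge set set" where
  "edge_pairs k = {{d, e} | d e. d \<in> edges \<and> e \<in> edges \<and> d \<noteq> e \<and> edge_dist d e = k}"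


section \<open>The coefficients\<close>

definition eps_table :: "(edge \<times> edge \<times> int) set" where
  "eps_table = (\<Union>i.
    { ((U i, V i), (U (i + 1), V (i + 1)), 2),
      ((U i, V i), (U (i - 1), V (i - 1)), 2),
      ((U i, V i), (U (i + 2), V (i + 2)), -2),
      ((U i, V i), (U (i - 2), V (i - 2)), -2),
      ((U i, V i), (U (i + 3), V (i + 3)), -3),
      ((U i, V i), (U (i - 3), V (i - 3)), -3),
      ((U i, V i), (U (i + 2), V (i + 1)), 1),
      ((U i, V i), (U (i - 1), V (i - 2)), 1),
      ((U i, V i), (U (i + 3), V (i + 2)), 2),
      ((U i, V i), (U (i - 2), V (i - 3)), 2),
      ((U i, V i), (U (i + 4), V (i + 3)), 5),
      ((U i, V i), (V (i + 1), U (i - 1)), 3),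
      ((U i, V i), (V (i + 3), U (i + 1)), 2),
      ((U i, V i), (V (i - 1), U (i + 4)), 2),
      ((U i, V i), (V (i + 4), U (i + 2)), -1),
      ((U i, V i), (V (i + 5), U (i + 3)), -1),
      ((U i, V (i - 1)), (U (i + 1), V i), 2),
      ((U i, V (i - 1)), (U (i - 1), V (i - 2)), 2),
      ((U i, V (i - 1)), (U (i + 2), V (i + 1)), 1),
      ((U i, V (i - 1)), (U (i - 2), V (i - 3)), 1),
      ((U i, V (i - 1)), (U (i + 3), V (i + 2)), -2),
      ((U i, V (i - 1)), (U (i - 3), V (i - 4)), -2),
      ((U i, V (i - 1)), (V i, U (i - 2)), 2),
      ((U i, V (i - 1)), (V (i + 1), U (i - 1)), 2),
      ((U i, V (i - 1)), (V (i + 3), U (i + 1)), 3),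
      ((U i, V (i - 1)), (V (i + 5), U (i + 3)), 3),
      ((U i, V (i - 1)), (V (i + 4), U (i + 2)), 3),
      ((V i, U (i - 2)), (V (i + 1), U (i - 1)), 5),
      ((V i, U (i - 2)), (V (i - 1), U (i - 3)), 5),
      ((V i, U (i - 2)), (V (i + 2), U i), 2),
      ((V i, U (i - 2)), (V (i - 2), U (i - 4)), 2),
      ((V i, U (i - 2)), (V (i + 3), U (i + 1)), 2),
      ((V i, U (i - 2)), (V (i - 3), U (i - 5)), 2) })"

text \<open>The value is uniquely determined by the table and the table covers all pairs of
  edges without a common vertex; see the lemmas \<open>eps_eq\<close> and \<open>eps_table_covers\<close>.\<close>

definition eps :: "edge set \<Rightarrow> int" where
  "eps p = (THE k. \<exists>d e. (d, e, k) \<in> eps_table \<and> p = {d, e})"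

lemma eps_table_unique:
  assumes "(d, e, k) \<in> eps_table" "(d', e', k') \<in> eps_table" "{d, e} = {d', e'}"
  shows "k = k'"
  using assms unfolding eps_table_def doubleton_eq_iff UN_iff
  by (elim bexE) (simp only: insert_iff empty_iff prod.inject, elim disjE conjE; simp)

lemma eps_eq: "eps {d, e} = k" if "(d, e, k) \<in> eps_table"
  unfolding eps_def using that eps_table_unique by (intro the_equality) blast+

lemma minus_seven:
  "i - 1 = i + (6 :: 7)" "i - 2 = i + (5 :: 7)" "i - 3 = i + (4 :: 7)" "i - 4 = i + (3 :: 7)"
  "i - 5 = i + (2 :: 7)"
  unfolding diff_conv_add_uminus add_left_cancel by simp_all

lemma seven_cases:
  fixes i j :: 7
  obtains "j = i" | "j = i + 1" | "j = i + 2" | "j = i + 3" | "j = i + 4" | "j = i + 5" | "j = i + 6"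
proof -
  obtain z :: int where z: "j - i = of_int z" "0 \<le> z" "z < 7"
    by (cases "j - i") auto
  from z(2,3) have "z = 0 \<or> z = 1 \<or> z = 2 \<or> z = 3 \<or> z = 4 \<or> z = 5 \<or> z = 6" by arith
  moreover have "j = i + of_int z" using z(1) by (metis add.commute diff_add_cancel)
  ultimately show ?thesis using that by fastforce
qed

lemma eps_table_covers:
  assumes "d \<in> edges" "e \<in> edges" "ends d \<inter> ends e = {}"
  shows "\<exists>k. (d, e, k) \<in> eps_table \<or> (e, d, k) \<in> eps_table"
proof -
  have T: "\<exists>k. (x, y, k) \<in> eps_table"
    if "\<exists>k. (x, y, k) \<in> R i" "eps_table = (\<Union>i. R i)" for x y i and R :: "7 \<Rightarrow> (edge \<times> edge \<times> int) set"
    using that by blast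
  note R = T[OF _ eps_table_def]
  have aa: "\<exists>k. ((U i, V i), (U j, V j), k) \<in> eps_table"
    if "ends (U i, V i) \<inter> ends (U j, V j) = {}" for i j
    by (rule seven_cases[of j i]; use that in \<open>intro R[where i = i], simp add: ends_def minus_seven add.assoc\<close>)
  have ab: "\<exists>k. ((U i, V i), (U j, V (j - 1)), k) \<in> eps_table"
    if "ends (U i, V i) \<inter> ends (U j, V (j - 1)) = {}" for i j
    by (rule seven_cases[of j i]; use that in \<open>intro R[where i = i], simp add: ends_def minus_seven add.assoc\<close>)
  have ac: "\<exists>k. ((U i, V i), (V j, U (j - 2)), k) \<in> eps_table"
    if "ends (U i, V i) \<inter> ends (V j, U (j - 2)) = {}" for i j
    by (rule seven_cases[of j i]; use that in \<open>intro R[where i = i], simp add: ends_def minus_seven add.assoc\<close>)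
  have bb: "\<exists>k. ((U i, V (i - 1)), (U j, V (j - 1)), k) \<in> eps_table"
    if "ends (U i, V (i - 1)) \<inter> ends (U j, V (j - 1)) = {}" for i j
    by (rule seven_cases[of j i]; use that in \<open>intro R[where i = i], simp add: ends_def minus_seven add.assoc\<close>)
  have bc: "\<exists>k. ((U i, V (i - 1)), (V j, U (j - 2)), k) \<in> eps_table"
    if "ends (U i, V (i - 1)) \<inter> ends (V j, U (j - 2)) = {}" for i j
    by (rule seven_cases[of j i]; use that in \<open>intro R[where i = i], simp add: ends_def minus_seven add.assoc\<close>)
  have cc: "\<exists>k. ((V i, U (i - 2)), (V j, U (j - 2)), k) \<in> eps_table"
    if "ends (V i, U (i - 2)) \<inter> ends (V j, U (j - 2)) = {}" for i j
    by (rule seven_cases[of j i]; use that in \<open>intro R[where i = i], simp add: ends_def minus_seven add.assoc\<close>)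
  have sym: "ends e \<inter> ends d = {}" using assms(3) by blast
  obtain i where "d = (U i, V i) \<or> d = (U i, V (i - 1)) \<or> d = (V i, U (i - 2))"
    using assms(1) unfolding edges_def by auto
  moreover obtain j where "e = (U j, V j) \<or> e = (U j, V (j - 1)) \<or> e = (V j, U (j - 2))"
    using assms(2) unfolding edges_def by auto
  ultimately show ?thesis
    using assms(3) sym aa[of i j] ab[of i j] ab[of j i] ac[of i j] ac[of j i] bb[of i j] bc[of i j]
      bc[of j i] cc[of i j] by (elim disjE) (simp_all only:, blast+)
qed


section \<open>The graph as a topological space\<close>

text \<open>The geometric realization: the vertices are the standard basis vectors of
  \<open>real ^ vertex\<close> and every edge is the segment joining its end vertices, parametrized
  from tail to head. As the graph is simple, distinct edges meet at most in a common vertex.\<close>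

definition edge_point :: "edge \<Rightarrow> real \<Rightarrow> real ^ vertex" where
  "edge_point d t = linepath (axis (fst d) 1) (axis (snd d) 1) t"

definition edge_arc :: "edge \<Rightarrow> (real ^ vertex) set" where
  "edge_arc d = edge_point d ` {0..1}"

definition HG :: "(real ^ vertex) set" where
  "HG = (\<Union>d\<in>edges. edge_arc d)"


section \<open>Plane generic immersions\<close>

text \<open>Smoothness on a closed interval, one-sided at its end points; \<open>F n\<close> is the
  \<open>n\<close>-th derivative.\<close>

definition smooth_on_interval :: "real \<Rightarrow> real \<Rightarrow> (real \<Rightarrow> 'a::real_normed_vector) \<Rightarrow> bool" where
  "smooth_on_interval a b g \<longleftrightarrow>
     (\<exists>F :: nat \<Rightarrow> real \<Rightarrow> 'a. F 0 = g \<and>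
        (\<forall>n. \<forall>t\<in>{a..b}. (F n has_vector_derivative F (Suc n) t) (at t within {a..b})))"

text \<open>\<open>S\<close> is the set of subdivision points.\<close>

definition piecewise_smooth :: "(real \<Rightarrow> 'a::real_normed_vector) \<Rightarrow> bool" where
  "piecewise_smooth g \<longleftrightarrow> continuous_on {0..1} g \<and>
     (\<exists>S. finite S \<and> (\<forall>a b. 0 \<le> a \<and> a < b \<and> b \<le> 1 \<and> {a<..<b} \<inter> S = {}
                        \<longrightarrow> smooth_on_interval a b g))"

definition plane_immersion :: "(real ^ vertex \<Rightarrow> real ^ 2) \<Rightarrow> bool" where
  "plane_immersion f \<longleftrightarrow>
     continuous_on HG f \<and>
     (\<forall>x\<in>HG. \<exists>N. open N \<and> x \<in> N \<and> inj_on f (N \<inter> HG)) \<and>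
     (\<forall>d\<in>edges. piecewise_smooth (f \<circ> edge_point d))"

definition multiple_points :: "(real ^ vertex \<Rightarrow> real ^ 2) \<Rightarrow> (real ^ 2) set" where
  "multiple_points f = {y. \<exists>x\<in>HG. \<exists>x'\<in>HG. x \<noteq> x' \<and> f x = y \<and> f x' = y}"

text \<open>The edges \<open>d\<close> and \<open>e\<close> may coincide. Transversality means that both strands have
  a velocity vector at the double point and that these are linearly independent.\<close>

definition transversal_double_point :: "(real ^ vertex \<Rightarrow> real ^ 2) \<Rightarrow> real ^ 2 \<Rightarrow> bool" where
  "transversal_double_point f y \<longleftrightarrow>
     (\<exists>d\<in>edges. \<exists>e\<in>edges. \<exists>s\<in>{0<..<1}. \<exists>t\<in>{0<..<1}. \<exists>v w.
        edge_point d s \<noteq> edge_point e t \<and>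
        {x \<in> HG. f x = y} = {edge_point d s, edge_point e t} \<and>
        (f \<circ> edge_point d has_vector_derivative v) (at s) \<and>
        (f \<circ> edge_point e has_vector_derivative w) (at t) \<and>
        det (vector [v, w] :: real ^ 2 ^ 2) \<noteq> 0)"

definition plane_generic_immersion :: "(real ^ vertex \<Rightarrow> real ^ 2) \<Rightarrow> bool" where
  "plane_generic_immersion f \<longleftrightarrow>
     plane_immersion f \<and> finite (multiple_points f) \<and>
     (\<forall>y\<in>multiple_points f. transversal_double_point f y)"


section \<open>Spatial embeddings and their diagrams\<close>

definition spatial_embedding :: "(real ^ vertex \<Rightarrow> real ^ 3) \<Rightarrow> bool" where
  "spatial_embedding \<phi> \<longleftrightarrow> embedding_map (top_of_set HG) euclidean \<phi>"

definition proj :: "real ^ 3 \<Rightarrow> real ^ 2" where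
  "proj p = vector [p $ 1, p $ 2]"

definition is_lift :: "(real ^ vertex \<Rightarrow> real ^ 3) \<Rightarrow> (real ^ vertex \<Rightarrow> real ^ 2) \<Rightarrow> bool" where
  "is_lift \<phi> f \<longleftrightarrow> (\<forall>x\<in>HG. f x = proj (\<phi> x))"

text \<open>At the crossing \<open>y\<close> of the diagram given by \<open>f\<close> and \<open>\<phi>\<close>, the strand of \<open>\<phi>\<close> lying
  higher in the third coordinate has velocity \<open>v\<close> in the plane, the lower one \<open>w\<close>.\<close>

definition over_under ::
  "(real ^ vertex \<Rightarrow> real ^ 2) \<Rightarrow> (real ^ vertex \<Rightarrow> real ^ 3) \<Rightarrow> real ^ 2 \<Rightarrow> real ^ 2 \<Rightarrow> real ^ 2 \<Rightarrow> bool" where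
  "over_under f \<phi> y v w \<longleftrightarrow>
     (\<exists>d\<in>edges. \<exists>e\<in>edges. \<exists>s\<in>{0<..<1}. \<exists>t\<in>{0<..<1}.
        f (edge_point d s) = y \<and> f (edge_point e t) = y \<and>
        \<phi> (edge_point d s) $ 3 > \<phi> (edge_point e t) $ 3 \<and>
        (f \<circ> edge_point d has_vector_derivative v) (at s) \<and>
        (f \<circ> edge_point e has_vector_derivative w) (at t))"

text \<open>Right-handed convention: a crossing is positive if the over-strand has to be turned
  counterclockwise (by less than a half turn) to point in the direction of the under-strand.\<close>

definition positive_crossing ::
  "(real ^ vertex \<Rightarrow> real ^ 2) \<Rightarrow> (real ^ vertex \<Rightarrow> real ^ 3) \<Rightarrow> real ^ 2 \<Rightarrow> bool" where
  "positive_crossing f \<phi> y \<longleftrightarrow>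
     (\<exists>v w. over_under f \<phi> y v w \<and> det (vector [v, w] :: real ^ 2 ^ 2) > 0)"

definition negative_crossing ::
  "(real ^ vertex \<Rightarrow> real ^ 2) \<Rightarrow> (real ^ vertex \<Rightarrow> real ^ 3) \<Rightarrow> real ^ 2 \<Rightarrow> bool" where
  "negative_crossing f \<phi> y \<longleftrightarrow>
     (\<exists>v w. over_under f \<phi> y v w \<and> det (vector [v, w] :: real ^ 2 ^ 2) < 0)"

text \<open>For \<open>p = {d, e}\<close> this is \<open>f d \<inter> f e\<close>.\<close>

definition common_points :: "(real ^ vertex \<Rightarrow> real ^ 2) \<Rightarrow> edge set \<Rightarrow> (real ^ 2) set" where
  "common_points f p = (\<Inter>d\<in>p. f ` edge_arc d)"

definition ell ::
  "(real ^ vertex \<Rightarrow> real ^ 2) \<Rightarrow> (real ^ vertex \<Rightarrow> real ^ 3) \<Rightarrow> edge set \<Rightarrow> int" where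
  "ell f \<phi> p = int (card {y \<in> common_points f p. positive_crossing f \<phi> y})
             - int (card {y \<in> common_points f p. negative_crossing f \<phi> y})"

definition L_inv ::
  "(real ^ vertex \<Rightarrow> real ^ 2) \<Rightarrow> (real ^ vertex \<Rightarrow> real ^ 3) \<Rightarrow> int" where
  "L_inv f \<phi> = (\<Sum>p\<in>edge_pairs 1 \<union> edge_pairs 2. eps p * ell f \<phi> p)"

end

theory Submission
  imports Defs "HOL-Complex_Analysis.Riemann_Mapping"
begin

text \<open>
  For disjoint edges \<open>d\<close>, \<open>e\<close> the crossings of \<open>f d\<close> and \<open>f e\<close> are the zeros of
  \<open>(s, t) \<mapsto> f (d s) - f (e t)\<close> on the unit square. By transversality their number is congruent
  modulo 2 to the winding number of this map along the boundary of the square, which is an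
  alternating sum of the turns of an edge as seen from an end vertex of the other edge. Such a turn
  is determined up to an integer \<open>n v d\<close> by the directions between the vertices, and the directions
  from \<open>v\<close> to \<open>w\<close> and from \<open>w\<close> to \<open>v\<close> differ by a half turn. Hence the number of crossings is
  modulo 2 the sum of four integers \<open>n v d\<close> and of a term that depends only on an arbitrarily chosen
  tournament on the vertices. In the sum over all pairs of edges at distance 2 every \<open>n v d\<close> occurs
  an even number of times, and a tournament invariant under the rotation of order 7 leaves an odd
  number. Finally \<open>\<epsilon>\<close> is odd exactly on the pairs at distance 2.
\<close>

section \<open>The index of a map on the unit square\<close>

lemma winding_number_exp:
  assumes "continuous_on {0..1} q" "\<And>t. t \<in> {0..1} \<Longrightarrow> p t = exp (q t)"
  shows "winding_number p 0 = (q 1 - q 0) / (2 * of_real pi * \<i>)"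
proof -
  have "winding_number p 0 = winding_number (exp \<circ> q) 0"
    by (rule winding_number_cong) (simp add: assms(2))
  then show ?thesis
    using winding_number_compose_exp[of q] assms(1) by (simp add: path_def pathfinish_def pathstart_def)
qed

lemma nonvanishing_path_log:
  fixes p :: "real \<Rightarrow> complex"
  assumes "continuous_on {0..1} p" "\<And>t. t \<in> {0..1} \<Longrightarrow> p t \<noteq> 0"
  \<comment> \<open>The interval is contractible, so a nonvanishing path has a continuous logarithm.
    Hence winding numbers of paths that need not be closed become increments of logarithms, and
    identities for them become identities for logarithms.\<close>
  obtains q where "continuous_on {0..1} q" "\<And>t. t \<in> {0..1} \<Longrightarrow> p t = exp (q t)"
    "winding_number p 0 = (q 1 - q 0) / (2 * of_real pi * \<i>)"
proof -
  obtain q where q: "continuous_on {0..1} q" "\<And>t. t \<in> {0..1} \<Longrightarrow> p t = exp (q t)"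
    using continuous_logarithm_on_contractible[OF assms(1)] assms(2) convex_imp_contractible
    by (metis convex_real_interval(5))
  with winding_number_exp[OF q] that show ?thesis by blast
qed

lemma winding_number_mult:
  fixes p q :: "real \<Rightarrow> complex"
  assumes "continuous_on {0..1} p" "\<And>t. t \<in> {0..1} \<Longrightarrow> p t \<noteq> 0"
    and "continuous_on {0..1} q" "\<And>t. t \<in> {0..1} \<Longrightarrow> q t \<noteq> 0"
  shows "winding_number (\<lambda>t. p t * q t) 0 = winding_number p 0 + winding_number q 0"
proof -
  obtain P where P: "continuous_on {0..1} P" "\<And>t. t \<in> {0..1} \<Longrightarrow> p t = exp (P t)"
    "winding_number p 0 = (P 1 - P 0) / (2 * of_real pi * \<i>)"
    using nonvanishing_path_log assms by metis
  obtain Q where Q: "continuous_on {0..1} Q" "\<And>t. t \<in> {0..1} \<Longrightarrow> q t = exp (Q t)"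
    "winding_number q 0 = (Q 1 - Q 0) / (2 * of_real pi * \<i>)"
    using nonvanishing_path_log assms by metis
  have "winding_number (\<lambda>t. p t * q t) 0
      = ((P 1 + Q 1) - (P 0 + Q 0)) / (2 * of_real pi * \<i>)"
    by (rule winding_number_exp) (auto intro!: continuous_intros P(1) Q(1) simp: P(2) Q(2) exp_add)
  then show ?thesis unfolding P(3) Q(3) by (simp add: diff_divide_distrib add_divide_distrib)
qed

text \<open>The conjugate of a logarithm is a logarithm of the conjugate path; the sign comes from
  conjugating the factor \<open>\<i>\<close> in the denominator.\<close>

lemma winding_number_cnj:
  fixes p :: "real \<Rightarrow> complex"
  assumes "continuous_on {0..1} p" "\<And>t. t \<in> {0..1} \<Longrightarrow> p t \<noteq> 0"
  shows "winding_number (\<lambda>t. cnj (p t)) 0 = - cnj (winding_number p 0)"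
proof -
  obtain P where P: "continuous_on {0..1} P" "\<And>t. t \<in> {0..1} \<Longrightarrow> p t = exp (P t)"
    "winding_number p 0 = (P 1 - P 0) / (2 * of_real pi * \<i>)"
    using nonvanishing_path_log assms by metis
  have "winding_number (\<lambda>t. cnj (p t)) 0 = (cnj (P 1) - cnj (P 0)) / (2 * of_real pi * \<i>)"
    by (rule winding_number_exp) (auto intro!: continuous_intros P(1) simp: P(2) exp_cnj)
  then show ?thesis unfolding P(3) by (simp add: field_simps)
qed

section \<open>Winding along the boundary of the square\<close>

definition unit_square :: "(real \<times> real) set" where
  "unit_square = {0..1} \<times> {0..1}"

definition square_boundary :: "(real \<times> real) set" where
  "square_boundary = {0..1} \<times> {0, 1} \<union> {0, 1} \<times> {0..1}"

lemma square_boundary_subset: "square_boundary \<subseteq> unit_square"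
  by (auto simp: square_boundary_def unit_square_def)

text \<open>The sides are bottom, right, top and left, with the signs of the counterclockwise
  boundary. The single terms belong to open paths and need not be integers; for nonvanishing
  continuous \<open>F\<close> the total is the usual winding number of a loop.\<close>

definition square_index :: "(real \<times> real \<Rightarrow> complex) \<Rightarrow> complex" where
  "square_index F = winding_number (\<lambda>s. F (s, 0)) 0 + winding_number (\<lambda>t. F (1, t)) 0
     - winding_number (\<lambda>s. F (s, 1)) 0 - winding_number (\<lambda>t. F (0, t)) 0"

lemma continuous_on_square_sides:
  assumes "continuous_on square_boundary F"
  shows "continuous_on {0..1} (\<lambda>s. F (s, 0))" "continuous_on {0..1} (\<lambda>s. F (s, 1))"
    "continuous_on {0..1} (\<lambda>t. F (0, t))" "continuous_on {0..1} (\<lambda>t. F (1, t))"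
  by (auto intro!: continuous_on_compose2[OF assms] continuous_intros simp: square_boundary_def)

lemma square_index_cong:
  assumes "\<And>z. z \<in> square_boundary \<Longrightarrow> F z = G z"
  shows "square_index F = square_index G"
  unfolding square_index_def
  by (intro arg_cong2[where f = "(-)"] arg_cong2[where f = "(+)"] winding_number_cong assms)
    (auto simp: square_boundary_def)

text \<open>The increments of one logarithm on the four sides cancel at the corners.\<close>

lemma square_index_exp:
  assumes "continuous_on square_boundary g" "\<And>z. z \<in> square_boundary \<Longrightarrow> F z = exp (g z)"
  shows "square_index F = 0"
  unfolding square_index_def
  by (subst (1 2 3 4) winding_number_exp[OF continuous_on_square_sides(1)[OF assms(1)]]
      winding_number_exp[OF continuous_on_square_sides(2)[OF assms(1)]]
      winding_number_exp[OF continuous_on_square_sides(3)[OF assms(1)]]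
      winding_number_exp[OF continuous_on_square_sides(4)[OF assms(1)]])
    (auto intro!: assms(2) simp: square_boundary_def field_simps)

lemma square_index_mult:
  assumes F: "continuous_on square_boundary F" "\<And>z. z \<in> square_boundary \<Longrightarrow> F z \<noteq> 0"
    and G: "continuous_on square_boundary G" "\<And>z. z \<in> square_boundary \<Longrightarrow> G z \<noteq> 0"
  shows "square_index (\<lambda>z. F z * G z) = square_index F + square_index G"
proof -
  note c = continuous_on_square_sides[OF F(1)] continuous_on_square_sides[OF G(1)]
  have n: "F z \<noteq> 0 \<and> G z \<noteq> 0" if "z \<in> square_boundary" for z
    using F(2) G(2) that by blast
  show ?thesis
    unfolding square_index_def
    by (subst winding_number_mult, (rule c, use n in \<open>force simp: square_boundary_def\<close>)+)+ simp
qed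

text \<open>The square is contractible, so \<open>F\<close> has a logarithm on all of it, in
  particular on the boundary.\<close>

lemma square_index_nonvanishing:
  assumes "continuous_on unit_square F" "\<And>z. z \<in> unit_square \<Longrightarrow> F z \<noteq> 0"
  shows "square_index F = 0"
proof -
  have "contractible unit_square"
    unfolding unit_square_def by (intro convex_imp_contractible convex_Times) auto
  then obtain g where "continuous_on unit_square g" "\<And>z. z \<in> unit_square \<Longrightarrow> F z = exp (g z)"
    using continuous_logarithm_on_contractible assms by metis
  then show ?thesis
    using square_boundary_subset by (intro square_index_exp[of g]) (auto intro: continuous_on_subset)
qed

text \<open>The model zero: its index is the winding number of the boundary of the square about an
  interior point.\<close>

lemma square_index_translate:
  assumes "0 < s\<^sub>0" "s\<^sub>0 < 1" "0 < t\<^sub>0" "t\<^sub>0 < 1"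
  shows "square_index (\<lambda>z. Complex (fst z - s\<^sub>0) (snd z - t\<^sub>0)) = 1"
proof -
  let ?z = "Complex s\<^sub>0 t\<^sub>0"
  let ?b = "linepath 0 1" and ?r = "linepath 1 (1 + \<i>)" and ?t = "linepath \<i> (1 + \<i>)"
    and ?l = "linepath 0 \<i>"
  have nz: "?z \<notin> path_image ?b" "?z \<notin> path_image ?r" "?z \<notin> path_image ?t" "?z \<notin> path_image ?l"
    using assms by (auto simp: path_image_def linepath_def complex_eq_iff)
  have nz': "?z \<notin> closed_segment (1 + \<i>) \<i>" "?z \<notin> closed_segment \<i> 0"
    using nz by (simp_all add: closed_segment_commute)
  \<comment> \<open>\<open>rectpath\<close> runs counterclockwise, so the top and left sides enter
    reversed; this matches the two minus signs in \<open>square_index\<close>.\<close>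
  have rect: "rectpath 0 (1 + \<i>) = ?b +++ ?r +++ reversepath ?t +++ reversepath ?l"
    by (simp add: rectpath_def Let_def complex_eq_iff Complex_eq)
  have rev: "winding_number (linepath (1 + \<i>) \<i>) ?z = - winding_number ?t ?z"
    "winding_number (linepath \<i> 0) ?z = - winding_number ?l ?z"
    using nz winding_number_reversepath[of ?t ?z] winding_number_reversepath[of ?l ?z] by simp_all
  have "winding_number (rectpath 0 (1 + \<i>)) ?z = 1"
    by (rule winding_number_rectpath) (use assms in \<open>auto simp: in_box_complex_iff\<close>)
  then have "winding_number ?b ?z + (winding_number ?r ?z + (- winding_number ?t ?z
      + - winding_number ?l ?z)) = 1"
    unfolding rect using nz nz' by (simp add: winding_number_join path_image_join rev)
  then have eq: "winding_number ?b ?z + winding_number ?r ?z - winding_number ?t ?z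
      - winding_number ?l ?z = 1"
    by (simp add: algebra_simps)
  have "square_index (\<lambda>z. Complex (fst z - s\<^sub>0) (snd z - t\<^sub>0)) = winding_number ?b ?z
      + winding_number ?r ?z - winding_number ?t ?z - winding_number ?l ?z"
    unfolding square_index_def winding_number_offset[of _ ?z]
    by (intro arg_cong2[where f = "(-)"] arg_cong2[where f = "(+)"] winding_number_cong)
      (auto simp: linepath_def complex_eq_iff algebra_simps)
  with eq show ?thesis by simp
qed

lemma square_index_cnj:
  assumes "continuous_on square_boundary F" "\<And>z. z \<in> square_boundary \<Longrightarrow> F z \<noteq> 0"
  shows "square_index (\<lambda>z. cnj (F z)) = - cnj (square_index F)"
proof -
  note c = continuous_on_square_sides[OF assms(1)]
  show ?thesis
    unfolding square_index_def
    by (subst winding_number_cnj, rule c, use assms(2) in \<open>force simp: square_boundary_def\<close>)+ simp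
qed

text \<open>A Rouche argument: divided by \<open>\<alpha> * F z\<close>, the sum is 1 plus a term of
  norm less than 1. It stays in the right half plane, where the principal logarithm is continuous,
  so the quotient contributes index 0.\<close>

lemma square_index_dominant:
  assumes F: "continuous_on square_boundary F" "\<And>z. z \<in> square_boundary \<Longrightarrow> F z \<noteq> 0"
    and G: "continuous_on square_boundary G" "\<And>z. z \<in> square_boundary \<Longrightarrow> norm (G z) = norm (F z)"
    and ab: "norm \<beta> < norm \<alpha>"
  shows "square_index (\<lambda>z. \<alpha> * F z + \<beta> * G z) = square_index F"
proof -
  define r where "r z = 1 + \<beta> / \<alpha> * (G z / F z)" for z
  have a: "\<alpha> \<noteq> 0" using ab by auto
  have re: "0 < Re (r z)" if "z \<in> square_boundary" for z
  proof -
    have "norm (\<beta> / \<alpha> * (G z / F z)) < 1"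
      using F(2)[OF that] G(2)[OF that] ab a by (simp add: norm_mult norm_divide)
    then show ?thesis using abs_Re_le_cmod[of "\<beta> / \<alpha> * (G z / F z)"] by (simp add: r_def)
  qed
  have rc: "continuous_on square_boundary r"
    unfolding r_def using F G(1) by (intro continuous_intros) auto
  have nz: "r z \<noteq> 0" if "z \<in> square_boundary" for z using re[OF that] by auto
  have "square_index (\<lambda>z. \<alpha> * r z) = 0"
  proof (rule square_index_exp)
    show "continuous_on square_boundary (\<lambda>z. Ln \<alpha> + Ln (r z))"
      using re by (intro continuous_intros continuous_on_Ln' rc) (auto simp: complex_nonpos_Reals_iff, force)
  qed (simp add: exp_add a nz)
  moreover have "square_index (\<lambda>z. \<alpha> * F z + \<beta> * G z) = square_index (\<lambda>z. \<alpha> * r z * F z)"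
    by (rule square_index_cong) (use a F(2) in \<open>simp add: r_def field_simps\<close>)
  moreover have "square_index (\<lambda>z. \<alpha> * r z * F z) = square_index (\<lambda>z. \<alpha> * r z) + square_index F"
    by (rule square_index_mult) (use a nz F rc in \<open>auto intro!: continuous_intros\<close>)
  ultimately show ?thesis by simp
qed

text \<open>A real-linear map is \<open>\<alpha> z + \<beta> cnj z\<close>, and its index is that of the dominant term.\<close>

lemma square_index_affine:
  assumes st: "0 < s\<^sub>0" "s\<^sub>0 < 1" "0 < t\<^sub>0" "t\<^sub>0 < 1" and pq: "Im (cnj p * q) \<noteq> 0"
  shows "square_index (\<lambda>z. (fst z - s\<^sub>0) *\<^sub>R p - (snd z - t\<^sub>0) *\<^sub>R q) \<in> {1, -1}"
proof -
  define F where "F z = Complex (fst z - s\<^sub>0) (snd z - t\<^sub>0)" for z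
  define \<alpha> \<beta> where "\<alpha> = (p + \<i> * q) / 2" and "\<beta> = (p - \<i> * q) / 2"
  have F: "continuous_on square_boundary F" "F z \<noteq> 0" if "z \<in> square_boundary" for z
    using st that unfolding F_def Complex_eq
    by (auto intro!: continuous_intros simp: square_boundary_def complex_eq_iff)
  have c: "continuous_on square_boundary F" unfolding F_def Complex_eq by (intro continuous_intros)
  have one: "square_index F = 1" using square_index_translate[OF st] by (simp add: F_def[abs_def])
  \<comment> \<open>Both sides are the determinant of the real-linear part, which has columns
    \<open>p\<close> and \<open>- q\<close>; nondegeneracy therefore makes one of the two terms
    dominant.\<close>
  have "(norm \<alpha>)\<^sup>2 - (norm \<beta>)\<^sup>2 = - Im (cnj p * q)"
    unfolding cmod_power2 by (simp add: \<alpha>_def \<beta>_def field_simps power2_eq_square)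
  then have ne: "norm \<alpha> \<noteq> norm \<beta>" using pq by auto
  have eq: "(fst z - s\<^sub>0) *\<^sub>R p - (snd z - t\<^sub>0) *\<^sub>R q = \<alpha> * F z + \<beta> * cnj (F z)" for z
    by (simp add: \<alpha>_def \<beta>_def F_def complex_eq_iff algebra_simps add_divide_distrib diff_divide_distrib)
  show ?thesis
  proof (cases "norm \<beta> < norm \<alpha>")
    case True
    have "square_index (\<lambda>z. \<alpha> * F z + \<beta> * cnj (F z)) = 1"
      unfolding one[symmetric]
      by (rule square_index_dominant) (use F c True in \<open>auto intro!: continuous_intros\<close>)
    then show ?thesis by (simp add: eq)
  next
    case False
    then have lt: "norm \<alpha> < norm \<beta>" using ne by simp
    have "square_index (\<lambda>z. \<beta> * cnj (F z) + \<alpha> * F z) = square_index (\<lambda>z. cnj (F z))"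
      by (rule square_index_dominant) (use F c lt in \<open>auto intro!: continuous_intros\<close>)
    also have "\<dots> = -1" using F by (subst square_index_cnj) (auto simp: c one)
    finally show ?thesis by (simp add: eq add.commute)
  qed
qed

text \<open>Dividing by the linear part at a zero removes this zero and changes the index by one.\<close>

lemma square_index_parity:
  fixes F :: "real \<times> real \<Rightarrow> complex"
  assumes "finite Z" "continuous_on unit_square F"
    and "Z = {z \<in> unit_square. F z = 0}" "Z \<subseteq> {0<..<1} \<times> {0<..<1}"
    and "\<And>z. z \<in> Z \<Longrightarrow> \<exists>p q. Im (cnj p * q) \<noteq> 0 \<and>
           (F has_derivative (\<lambda>h. fst h *\<^sub>R p - snd h *\<^sub>R q)) (at z within unit_square)"
  shows "\<exists>m. square_index F = of_int m \<and> even (m - int (card Z))"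
  using assms
proof (induction Z arbitrary: F rule: finite_induct)
  case empty
  then have "square_index F = 0" by (intro square_index_nonvanishing) auto
  then show ?case by (intro exI[of _ 0]) simp
next
  case (insert z\<^sub>0 Z)
  obtain p q where pq: "Im (cnj p * q) \<noteq> 0"
    and der: "(F has_derivative (\<lambda>h. fst h *\<^sub>R p - snd h *\<^sub>R q)) (at z\<^sub>0 within unit_square)"
    using insert.prems(4) by blast
  obtain s\<^sub>0 t\<^sub>0 where z0: "z\<^sub>0 = (s\<^sub>0, t\<^sub>0)" by (cases z\<^sub>0)
  have st: "0 < s\<^sub>0" "s\<^sub>0 < 1" "0 < t\<^sub>0" "t\<^sub>0 < 1" using insert.prems(3) z0 by auto
  have Fz0: "F z\<^sub>0 = 0" and z0S: "z\<^sub>0 \<in> unit_square" using insert.prems(2) by auto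
  define L where "L h = fst h *\<^sub>R p - snd h *\<^sub>R q" for h :: "real \<times> real"
  define \<phi> where "\<phi> z = L (z - z\<^sub>0)" for z
  have linL: "linear L" unfolding L_def
    by (intro linearI) (auto simp: algebra_simps)
  have L0: "h = 0" if "L h = 0" for h
  proof -
    \<comment> \<open>Cramer's rule for the real system
      \<open>L h = fst h *\<^sub>R p - snd h *\<^sub>R q\<close>.\<close>
    have "fst h * Im (cnj p * q) = Im (cnj (L h) * q)" "snd h * Im (cnj p * q) = Im (cnj p * - L h)"
      by (simp_all add: L_def algebra_simps)
    then have "fst h = 0" "snd h = 0" using that pq by auto
    then show ?thesis by (simp add: prod_eq_iff)
  qed
  \<comment> \<open>The linear lower bound makes the remainder in the derivative of \<open>F\<close>
    at \<open>z\<^sub>0\<close> small relative to \<open>\<phi>\<close>, so that the quotient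
    \<open>F / \<phi>\<close> has a limit.\<close>
  then obtain c where c: "c > 0" "\<And>h. c * norm h \<le> norm (L h)"
    using linear_inj_bounded_below_pos[OF linL] linear_injective_0[OF linL] by blast
  have \<phi>0: "\<phi> z = 0 \<longleftrightarrow> z = z\<^sub>0" for z using L0[of "z - z\<^sub>0"] linear_0[OF linL] by (auto simp: \<phi>_def)
  have \<phi>c: "continuous_on A \<phi>" for A unfolding \<phi>_def L_def by (intro continuous_intros)
  \<comment> \<open>The value 1 is the limit of the quotient at \<open>z\<^sub>0\<close>, because
    \<open>\<phi>\<close> is the linearization of \<open>F\<close> there. Thus \<open>G\<close> is
    continuous and loses exactly this zero.\<close>
  define G where "G z = (if z = z\<^sub>0 then 1 else F z / \<phi> z)" for z
  have "((\<lambda>z. F z / \<phi> z) \<longlongrightarrow> 1) (at z\<^sub>0 within unit_square)"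
  proof -
    have lim: "((\<lambda>z. (norm (F z - \<phi> z) / norm (z - z\<^sub>0)) / c) \<longlongrightarrow> 0 / c) (at z\<^sub>0 within unit_square)"
      using der c(1) unfolding has_derivative_within L_def[symmetric]
      by (intro tendsto_divide tendsto_const)
        (auto simp: Fz0 \<phi>_def tendsto_norm_zero_iff divide_inverse mult.commute
          simp flip: tendsto_norm_zero_iff[where f = "\<lambda>y. _ y *\<^sub>R _ y"])
    have "((\<lambda>z. F z / \<phi> z - 1) \<longlongrightarrow> 0) (at z\<^sub>0 within unit_square)"
    proof (rule Lim_null_comparison)
      show "\<forall>\<^sub>F z in at z\<^sub>0 within unit_square.
          norm (F z / \<phi> z - 1) \<le> (norm (F z - \<phi> z) / norm (z - z\<^sub>0)) / c"
        unfolding eventually_at_filter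
      proof (intro always_eventually allI impI)
        fix z assume "z \<noteq> z\<^sub>0"
        then have "norm (F z / \<phi> z - 1) = norm (F z - \<phi> z) / norm (\<phi> z)"
          by (simp add: \<phi>0 norm_divide[symmetric] diff_divide_distrib)
        also have "\<dots> \<le> norm (F z - \<phi> z) / (c * norm (z - z\<^sub>0))"
          using c \<phi>0[of z] \<open>z \<noteq> z\<^sub>0\<close> by (intro divide_left_mono mult_pos_pos) (auto simp: \<phi>_def)
        finally show "norm (F z / \<phi> z - 1) \<le> (norm (F z - \<phi> z) / norm (z - z\<^sub>0)) / c"
          by (simp add: mult.commute)
      qed
    qed (use lim in simp)
    then show ?thesis by (simp add: LIM_zero_iff)
  qed
  then have Gz0: "continuous (at z\<^sub>0 within unit_square) G"
    unfolding continuous_within G_def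
    by (auto elim!: Lim_transform_eventually simp: eventually_at_filter)
  have near: "\<forall>\<^sub>F w in at z within unit_square. F w / \<phi> w = G w" if "z \<noteq> z\<^sub>0" for z
    using eventually_neq_at_within[of z\<^sub>0 z unit_square] by eventually_elim (simp add: G_def)
  have Gc: "continuous_on unit_square G"
    unfolding continuous_on_eq_continuous_within
  proof
    fix z assume z: "z \<in> unit_square"
    show "continuous (at z within unit_square) G"
    proof (cases "z = z\<^sub>0")
      case False
      have "((\<lambda>w. F w / \<phi> w) \<longlongrightarrow> F z / \<phi> z) (at z within unit_square)"
        using insert.prems(1) \<phi>c[of unit_square] z False
        by (intro tendsto_divide) (auto simp: continuous_on_def \<phi>0)
      then show ?thesis
        unfolding continuous_within using False near[OF False]
        by (auto elim!: Lim_transform_eventually simp: G_def)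
    qed (simp add: Gz0)
  qed
  have "\<exists>m. square_index G = of_int m \<and> even (m - int (card Z))"
  proof (rule insert.IH[OF Gc])
    show "Z = {z \<in> unit_square. G z = 0}"
      using insert.prems(2) insert.hyps(2) by (auto simp: G_def \<phi>0)
    show "Z \<subseteq> {0<..<1} \<times> {0<..<1}" using insert.prems(3) by auto
  next
    fix z assume z: "z \<in> Z"
    then have ne: "z \<noteq> z\<^sub>0" and Fz: "F z = 0" and zS: "z \<in> unit_square"
      using insert.prems(2) insert.hyps(2) by auto
    obtain p' q' where pq': "Im (cnj p' * q') \<noteq> 0"
      "(F has_derivative (\<lambda>h. fst h *\<^sub>R p' - snd h *\<^sub>R q')) (at z within unit_square)"
      using insert.prems(4) z by blast
    \<comment> \<open>At another zero the numerator of the quotient rule keeps only the derivative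
      of \<open>F\<close>. Both \<open>p'\<close> and \<open>q'\<close> are divided by the complex
      number \<open>\<phi> z\<close>, which scales the determinant by a positive factor.\<close>
    have "(\<phi> has_derivative L) (at z within unit_square)"
      unfolding \<phi>_def[abs_def] L_def[abs_def] by (auto intro!: derivative_eq_intros)
    from has_derivative_divide[OF pq'(2) this] ne
    have "((\<lambda>w. F w / \<phi> w) has_derivative (\<lambda>h. fst h *\<^sub>R (p' / \<phi> z) - snd h *\<^sub>R (q' / \<phi> z)))
        (at z within unit_square)"
      by (simp add: \<phi>0 Fz scaleR_conv_of_real field_simps)
    then have "(G has_derivative (\<lambda>h. fst h *\<^sub>R (p' / \<phi> z) - snd h *\<^sub>R (q' / \<phi> z)))
        (at z within unit_square)"
      by (rule has_derivative_transform_eventually[OF _ near[OF ne]]) (simp_all add: G_def ne zS)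
    moreover have "cnj (p' / \<phi> z) * (q' / \<phi> z) = (cnj p' * q') / of_real ((norm (\<phi> z))\<^sup>2)"
      unfolding complex_norm_square by (simp add: mult.commute)
    then have "Im (cnj (p' / \<phi> z) * (q' / \<phi> z)) = Im (cnj p' * q') / (norm (\<phi> z))\<^sup>2"
      by (simp only: Im_divide_of_real)
    then have "Im (cnj (p' / \<phi> z) * (q' / \<phi> z)) \<noteq> 0"
      using pq'(1) ne \<phi>0[of z] by (simp del: times_complex.sel complex_cnj_divide)
    ultimately show "\<exists>p q. Im (cnj p * q) \<noteq> 0 \<and>
        (G has_derivative (\<lambda>h. fst h *\<^sub>R p - snd h *\<^sub>R q)) (at z within unit_square)" by blast
  qed
  then obtain m where m: "square_index G = of_int m" "even (m - int (card Z))" by blast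
  have bd: "z \<noteq> z\<^sub>0 \<and> G z \<noteq> 0" if "z \<in> square_boundary" for z
  proof -
    have "z \<notin> insert z\<^sub>0 Z" using that insert.prems(3) by (auto simp: square_boundary_def)
    then show ?thesis using that insert.prems(2) square_boundary_subset by (auto simp: G_def \<phi>0)
  qed
  have "square_index F = square_index (\<lambda>z. \<phi> z * G z)"
    by (rule square_index_cong) (use bd in \<open>auto simp: G_def \<phi>0\<close>)
  also have "\<dots> = square_index \<phi> + square_index G"
    using bd \<phi>0 \<phi>c Gc square_boundary_subset by (intro square_index_mult) (auto intro: continuous_on_subset)
  finally have "square_index F = square_index \<phi> + of_int m" using m(1) by simp
  \<comment> \<open>Whichever sign the removed zero has, its contribution is odd, as is the change
    of the cardinality.\<close>
  moreover have "square_index \<phi> \<in> {1, -1}"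
    using square_index_affine[OF st pq] by (simp add: \<phi>_def[abs_def] L_def z0)
  ultimately show ?case
    using m(2) insert.hyps
    by (auto intro: exI[of _ "m + 1"] exI[of _ "m - 1"])
qed

section \<open>Crossings of disjoint edges\<close>

lemma adjacent_simps:
  "\<not> adjacent (U i) (U j)" "\<not> adjacent (V i) (V j)"
  "adjacent (U i) (V j) \<longleftrightarrow> j \<in> {i, i - 1, i + 2}"
  "adjacent (V j) (U i) \<longleftrightarrow> j \<in> {i, i - 1, i + 2}"
  by (auto simp: adjacent_def edges_def algebra_simps)

lemma edge_no_reverse: "(x, y) \<in> edges \<Longrightarrow> (y, x) \<notin> edges"
  by (auto simp: edges_def minus_seven add.assoc)

lemma edge_no_loop: "d \<in> edges \<Longrightarrow> fst d \<noteq> snd d"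
  by (auto simp: edges_def)

lemma edge_ends_inject: "d \<in> edges \<Longrightarrow> e \<in> edges \<Longrightarrow> ends d = ends e \<longleftrightarrow> d = e"
  using edge_no_reverse by (cases d, cases e) (auto simp: ends_def doubleton_eq_iff)

lemma edge_point_nth:
  "edge_point d s $ x = (if x = fst d then 1 - s else 0) + (if x = snd d then s else 0)"
  by (auto simp: edge_point_def linepath_def axis_def)

lemma edge_point_ends: "edge_point d 0 = axis (fst d) 1" "edge_point d 1 = axis (snd d) 1"
  by (simp_all add: edge_point_def linepath_def)

text \<open>The support of the barycentric coordinates of an interior point recovers the end
  vertices, and hence the edge.\<close>

lemma edge_point_support:
  assumes "d \<in> edges" "0 < s" "s < 1"
  shows "{x. edge_point d s $ x \<noteq> 0} = ends d"
  using assms edge_no_loop[of d] by (auto simp: edge_point_nth ends_def)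

lemma edge_point_support_subset: "{x. edge_point d s $ x \<noteq> 0} \<subseteq> ends d"
  by (auto simp: edge_point_nth ends_def split: if_splits)

lemma edge_point_nonzero: "\<exists>x. edge_point d s $ x \<noteq> 0"
proof (rule ccontr)
  assume "\<nexists>x. edge_point d s $ x \<noteq> 0"
  then have "edge_point d s $ fst d = 0" "edge_point d s $ snd d = 0" by auto
  then show False by (auto simp: edge_point_nth split: if_splits)
qed

lemma edge_point_inject:
  assumes "d \<in> edges" "e \<in> edges" "s \<in> {0<..<1}" "t \<in> {0<..<1}"
  shows "edge_point d s = edge_point e t \<longleftrightarrow> d = e \<and> s = t"
proof
  assume eq: "edge_point d s = edge_point e t"
  have "ends d = ends e"
    using edge_point_support[of d s] edge_point_support[of e t] assms eq by auto
  then have "d = e" using edge_ends_inject assms by blast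
  moreover have "edge_point d s $ snd d = edge_point e t $ snd d" using eq by simp
  ultimately show "d = e \<and> s = t" using edge_no_loop[OF assms(1)] by (simp add: edge_point_nth)
qed simp

lemma edge_point_neq_axis:
  assumes "d \<in> edges" "s \<in> {0<..<1}"
  shows "edge_point d s \<noteq> axis x 1"
proof
  assume "edge_point d s = axis x 1"
  moreover have "edge_point d s $ fst d \<noteq> 0" "edge_point d s $ snd d \<noteq> 0"
    using assms edge_no_loop[OF assms(1)] by (auto simp: edge_point_nth)
  ultimately show False using edge_no_loop[OF assms(1)] by (auto simp: axis_def split: if_splits)
qed

lemma edge_point_disjoint:
  assumes "ends d \<inter> ends e = {}"
  shows "edge_point d s \<noteq> edge_point e t"
  using assms edge_point_nonzero[of d s] edge_point_support_subset[of d s]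
    edge_point_support_subset[of e t] by force

lemma edge_point_in_HG: "d \<in> edges \<Longrightarrow> s \<in> {0..1} \<Longrightarrow> edge_point d s \<in> HG"
  unfolding HG_def edge_arc_def by blast

lemma axis_in_HG: "axis v 1 \<in> HG"
proof -
  obtain i where "v = U i \<or> v = V i" by (cases v) auto
  moreover have "(U i, V i) \<in> edges" by (auto simp: edges_def)
  ultimately show ?thesis
    using edge_point_in_HG[of "(U i, V i)" 0] edge_point_in_HG[of "(U i, V i)" 1]
    by (auto simp: edge_point_ends)
qed

lemma multiple_pointsI:
  assumes "x \<in> HG" "x' \<in> HG" "x \<noteq> x'" "f x = f x'"
  shows "f x \<in> multiple_points f"
  using assms by (auto simp: multiple_points_def)

lemma det_vector_2: "det (vector [v, w] :: real ^ 2 ^ 2) = v $ 1 * w $ 2 - v $ 2 * w $ 1"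
  by (simp add: det_2)

section \<open>Double points and crossing signs of a generic immersion\<close>

context
  fixes f :: "real ^ vertex \<Rightarrow> real ^ 2"
  assumes gen: "plane_generic_immersion f"
begin

text \<open>A second preimage would make the image of the vertex a multiple point, but all preimages
  of such a point are interior to edges.\<close>

lemma vertex_image_unique:
  assumes "x \<in> HG" "f x = f (axis v 1)"
  shows "x = axis v 1"
proof (rule ccontr)
  assume "x \<noteq> axis v 1"
  then have "f (axis v 1) \<in> multiple_points f"
    using multiple_pointsI[OF axis_in_HG[of v] assms(1), of f] assms(2) by auto
  then have "transversal_double_point f (f (axis v 1))"
    using gen by (auto simp: plane_generic_immersion_def)
  then obtain d e s t where "d \<in> edges" "e \<in> edges" "s \<in> {0<..<1}" "t \<in> {0<..<1}"
    "{x \<in> HG. f x = f (axis v 1)} = {edge_point d s, edge_point e t}"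
    unfolding transversal_double_point_def by blast
  moreover from this have "axis v 1 \<in> {edge_point d s, edge_point e t}"
    using axis_in_HG[of v] by blast
  ultimately show False using edge_point_neq_axis by (metis insertE singletonD)
qed

lemma interior_of_not_vertex:
  assumes "s \<in> {0..1}" "\<And>v. edge_point d s \<noteq> axis v 1"
  shows "s \<in> {0<..<1}"
  using assms edge_point_ends[of d] by (force simp: less_le)

text \<open>Transversality supplies some two strands through the point. Since interior points
  determine edge and parameter, these are the given strands up to order, and exchanging them only
  changes the sign of the determinant.\<close>

lemma crossing_of_disjoint_edges:
  assumes d: "d \<in> edges" and e: "e \<in> edges" and disj: "ends d \<inter> ends e = {}"
    and s: "s \<in> {0..1}" and t: "t \<in> {0..1}" and eq: "f (edge_point d s) = f (edge_point e t)"
  obtains v w where "s \<in> {0<..<1}" "t \<in> {0<..<1}"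
    "{x \<in> HG. f x = f (edge_point d s)} = {edge_point d s, edge_point e t}"
    "(f \<circ> edge_point d has_vector_derivative v) (at s)"
    "(f \<circ> edge_point e has_vector_derivative w) (at t)"
    "det (vector [v, w] :: real ^ 2 ^ 2) \<noteq> 0"
proof -
  have ne: "edge_point d s \<noteq> edge_point e t" by (rule edge_point_disjoint[OF disj])
  have HG: "edge_point d s \<in> HG" "edge_point e t \<in> HG" using edge_point_in_HG d e s t by auto
  have "edge_point d s \<noteq> axis v 1" "edge_point e t \<noteq> axis v 1" for v
    using vertex_image_unique[OF HG(1), of v] vertex_image_unique[OF HG(2), of v] eq ne by auto
  then have s': "s \<in> {0<..<1}" and t': "t \<in> {0<..<1}"
    using interior_of_not_vertex[OF s] interior_of_not_vertex[OF t] by blast+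
  have "transversal_double_point f (f (edge_point d s))"
    using gen multiple_pointsI[OF HG ne eq] by (auto simp: plane_generic_immersion_def)
  then obtain d' e' s' t' v w where *: "d' \<in> edges" "e' \<in> edges" "s' \<in> {0<..<1}" "t' \<in> {0<..<1}"
    "{x \<in> HG. f x = f (edge_point d s)} = {edge_point d' s', edge_point e' t'}"
    "(f \<circ> edge_point d' has_vector_derivative v) (at s')"
    "(f \<circ> edge_point e' has_vector_derivative w) (at t')"
    "det (vector [v, w] :: real ^ 2 ^ 2) \<noteq> 0"
    unfolding transversal_double_point_def by blast
  have mem: "edge_point d s \<in> {edge_point d' s', edge_point e' t'}"
    "edge_point e t \<in> {edge_point d' s', edge_point e' t'}"
    unfolding *(5)[symmetric] using HG eq by auto
  then consider "edge_point d s = edge_point d' s'" "edge_point e t = edge_point e' t'"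
    | "edge_point d s = edge_point e' t'" "edge_point e t = edge_point d' s'"
    using ne by auto
  then show thesis
  proof cases
    case 1
    then have "d = d'" "s = s'" "e = e'" "t = t'"
      using edge_point_inject d e s' t' * by blast+
    then show thesis using that[OF s' t', of v w] * by simp
  next
    case 2
    then have "d = e'" "s = t'" "e = d'" "t = s'"
      using edge_point_inject d e s' t' * by blast+
    moreover have "det (vector [w, v] :: real ^ 2 ^ 2) \<noteq> 0" using *(8) by (simp add: det_vector_2 mult.commute)
    ultimately show thesis using that[OF s' t', of w v] * by (simp add: insert_commute)
  qed
qed

lemma common_points_doubleton:
  "common_points f {d, e} = {y. \<exists>s\<in>{0..1}. \<exists>t\<in>{0..1}. y = f (edge_point d s) \<and> y = f (edge_point e t)}"
  by (auto simp: common_points_def edge_arc_def)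

lemma finite_common_points:
  assumes "d \<in> edges" "e \<in> edges" "ends d \<inter> ends e = {}"
  shows "finite (common_points f {d, e})"
proof (rule finite_subset)
  show "common_points f {d, e} \<subseteq> multiple_points f"
  proof
    fix y assume "y \<in> common_points f {d, e}"
    then obtain s t where st: "s \<in> {0..1}" "t \<in> {0..1}"
      and y: "y = f (edge_point d s)" "f (edge_point d s) = f (edge_point e t)"
      by (auto simp: common_points_doubleton)
    show "y \<in> multiple_points f"
      unfolding y(1)
      by (rule multiple_pointsI[OF edge_point_in_HG[OF assms(1) st(1)]
            edge_point_in_HG[OF assms(2) st(2)] edge_point_disjoint[OF assms(3)] y(2)])
  qed
  show "finite (multiple_points f)" using gen by (simp add: plane_generic_immersion_def)
qed

text \<open>Injectivity holds because a double point has only two preimages, one on each of the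
  disjoint edges. Counting crossings thus becomes counting zeros on the square.\<close>

lemma bij_betw_common_points:
  assumes "d \<in> edges" "e \<in> edges" "ends d \<inter> ends e = {}"
  shows "bij_betw (\<lambda>z. f (edge_point d (fst z)))
    {z \<in> {0..1} \<times> {0..1}. f (edge_point d (fst z)) = f (edge_point e (snd z))} (common_points f {d, e})"
proof (intro bij_betw_imageI inj_onI)
  fix z z'
  assume z: "z \<in> {z \<in> {0..1} \<times> {0..1}. f (edge_point d (fst z)) = f (edge_point e (snd z))}"
    and z': "z' \<in> {z \<in> {0..1} \<times> {0..1}. f (edge_point d (fst z)) = f (edge_point e (snd z))}"
    and eq: "f (edge_point d (fst z)) = f (edge_point d (fst z'))"
  obtain s t s' t' where st: "z = (s, t)" "z' = (s', t')" by (cases z, cases z')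
  have a: "s \<in> {0<..<1}" "t \<in> {0<..<1}"
    "{x \<in> HG. f x = f (edge_point d s)} = {edge_point d s, edge_point e t}"
    using crossing_of_disjoint_edges[OF assms, of s t] z st by auto
  have b: "s' \<in> {0<..<1}" "t' \<in> {0<..<1}"
    "{x \<in> HG. f x = f (edge_point d s')} = {edge_point d s', edge_point e t'}"
    using crossing_of_disjoint_edges[OF assms, of s' t'] z' st by auto
  have "{edge_point d s, edge_point e t} = {edge_point d s', edge_point e t'}"
    using a(3) b(3) eq st by simp
  then have "edge_point d s = edge_point d s'" "edge_point e t = edge_point e t'"
    using edge_point_disjoint[OF assms(3)] by (metis doubleton_eq_iff)+
  then show "z = z'"
    using edge_point_inject[OF assms(1,1) a(1) b(1)] edge_point_inject[OF assms(2,2) a(2) b(2)] st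
    by simp
qed (force simp: common_points_doubleton)

lemma crossing_sign:
  fixes \<phi> :: "real ^ vertex \<Rightarrow> real ^ 3"
  assumes emb: "spatial_embedding \<phi>" and lift: "is_lift \<phi> f"
    and de: "d \<in> edges" "e \<in> edges" "ends d \<inter> ends e = {}"
    and y: "y \<in> common_points f {d, e}"
  shows "negative_crossing f \<phi> y \<longleftrightarrow> \<not> positive_crossing f \<phi> y"
proof -
  obtain s t where s: "s \<in> {0..1}" and t: "t \<in> {0..1}"
    and ys: "f (edge_point d s) = y" and yt: "f (edge_point e t) = y"
    using y[unfolded common_points_doubleton] by auto
  obtain v w where st: "s \<in> {0<..<1}" "t \<in> {0<..<1}"
    and two: "{x \<in> HG. f x = y} = {edge_point d s, edge_point e t}"
    and v: "(f \<circ> edge_point d has_vector_derivative v) (at s)"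
    and w: "(f \<circ> edge_point e has_vector_derivative w) (at t)"
    and det: "det (vector [v, w] :: real ^ 2 ^ 2) \<noteq> 0"
    using crossing_of_disjoint_edges[OF de s t, unfolded ys yt, OF refl] .
  define h where "h x = \<phi> x $ 3" for x
  have HG: "edge_point d s \<in> HG" "edge_point e t \<in> HG" using edge_point_in_HG de s t by auto
  \<comment> \<open>The lift has equal first two coordinates at the two preimages, so injectivity of
    the embedding separates the third.\<close>
  have hne: "h (edge_point d s) \<noteq> h (edge_point e t)"
  proof
    assume eq: "h (edge_point d s) = h (edge_point e t)"
    have "proj (\<phi> (edge_point d s)) = proj (\<phi> (edge_point e t))"
      using lift HG ys yt by (simp add: is_lift_def)
    then have "\<phi> (edge_point d s) $ 1 = \<phi> (edge_point e t) $ 1"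
      "\<phi> (edge_point d s) $ 2 = \<phi> (edge_point e t) $ 2"
      unfolding proj_def by (metis vector_2)+
    then have "\<phi> (edge_point d s) = \<phi> (edge_point e t)"
      using eq by (simp add: vec_eq_iff forall_3 h_def)
    moreover have "inj_on \<phi> HG"
      using emb by (simp add: spatial_embedding_def embedding_map_def homeomorphic_eq_everything_map)
    ultimately show False
      using HG edge_point_disjoint[OF de(3)] by (auto dest: inj_onD)
  qed
  \<comment> \<open>The heights and the uniqueness of derivatives leave just one pair of velocities,
    so the sign of one nonzero determinant decides.\<close>
  have over: "over_under f \<phi> y a b \<longleftrightarrow>
      h (edge_point d s) > h (edge_point e t) \<and> a = v \<and> b = w \<or>
      h (edge_point d s) < h (edge_point e t) \<and> a = w \<and> b = v" for a b
  proof
    assume "over_under f \<phi> y a b"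
    then obtain d' e' s' t' where *: "d' \<in> edges" "e' \<in> edges" "s' \<in> {0<..<1}" "t' \<in> {0<..<1}"
      "f (edge_point d' s') = y" "f (edge_point e' t') = y"
      "h (edge_point d' s') > h (edge_point e' t')"
      "(f \<circ> edge_point d' has_vector_derivative a) (at s')"
      "(f \<circ> edge_point e' has_vector_derivative b) (at t')"
      unfolding over_under_def h_def by blast
    have "edge_point d' s' \<in> {x \<in> HG. f x = y}" "edge_point e' t' \<in> {x \<in> HG. f x = y}"
      using * by (auto intro!: edge_point_in_HG)
    then consider "edge_point d' s' = edge_point d s" "edge_point e' t' = edge_point e t"
      | "edge_point d' s' = edge_point e t" "edge_point e' t' = edge_point d s"
      unfolding two using *(7) by auto
    then show "h (edge_point d s) > h (edge_point e t) \<and> a = v \<and> b = w \<or>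
      h (edge_point d s) < h (edge_point e t) \<and> a = w \<and> b = v"
    proof cases
      case 1
      then have "d' = d" "s' = s" "e' = e" "t' = t" using edge_point_inject de st * by blast+
      then show ?thesis using * v w by (auto dest: vector_derivative_unique_at)
    next
      case 2
      then have "d' = e" "s' = t" "e' = d" "t' = s" using edge_point_inject de st * by blast+
      then show ?thesis using * v w by (auto dest: vector_derivative_unique_at)
    qed
  next
    assume "h (edge_point d s) > h (edge_point e t) \<and> a = v \<and> b = w \<or>
      h (edge_point d s) < h (edge_point e t) \<and> a = w \<and> b = v"
    then show "over_under f \<phi> y a b"
      unfolding over_under_def h_def
      by (elim disjE conjE) (use de st ys yt v w in \<open>simp, metis\<close>)+
  qed
  show ?thesis
  proof (cases "h (edge_point d s) > h (edge_point e t)")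
    case True
    then have "over_under f \<phi> y a b \<longleftrightarrow> a = v \<and> b = w" for a b using over by auto
    then show ?thesis using det by (auto simp: positive_crossing_def negative_crossing_def)
  next
    case False
    then have "over_under f \<phi> y a b \<longleftrightarrow> a = w \<and> b = v" for a b using over hne by auto
    then show ?thesis
      using det by (auto simp: positive_crossing_def negative_crossing_def det_vector_2 algebra_simps)
  qed
qed

text \<open>Every crossing has exactly one sign, and the difference of the two counts has the parity
  of their sum.\<close>

lemma ell_parity:
  fixes \<phi> :: "real ^ vertex \<Rightarrow> real ^ 3"
  assumes "spatial_embedding \<phi>" "is_lift \<phi> f" "d \<in> edges" "e \<in> edges" "ends d \<inter> ends e = {}"
  shows "even (ell f \<phi> {d, e} - int (card (common_points f {d, e})))"
proof -
  let ?C = "common_points f {d, e}"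
  let ?P = "{y \<in> ?C. positive_crossing f \<phi> y}" and ?N = "{y \<in> ?C. negative_crossing f \<phi> y}"
  have "card (?P \<union> ?N) = card ?P + card ?N"
    using finite_common_points[OF assms(3-5)] crossing_sign[OF assms] by (intro card_Un_disjoint) auto
  moreover have "?P \<union> ?N = ?C" using crossing_sign[OF assms] by auto
  ultimately have "card ?C = card ?P + card ?N" by simp
  then show ?thesis by (simp add: ell_def)
qed

end

section \<open>Parity of the number of crossings\<close>

definition complex_of_plane :: "real ^ 2 \<Rightarrow> complex" where
  "complex_of_plane p = Complex (p $ 1) (p $ 2)"

lemma complex_of_plane_inject: "complex_of_plane p = complex_of_plane q \<longleftrightarrow> p = q"
  by (simp add: complex_of_plane_def vec_eq_iff forall_2)

lemma bounded_linear_complex_of_plane: "bounded_linear complex_of_plane"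
  unfolding linear_conv_bounded_linear[symmetric]
  by (rule linearI) (simp_all add: complex_of_plane_def complex_eq_iff)

lemma det_vector_complex_of_plane:
  "det (vector [v, w] :: real ^ 2 ^ 2) = Im (cnj (complex_of_plane v) * complex_of_plane w)"
  by (simp add: det_2 complex_of_plane_def)

definition edge_path :: "(real ^ vertex \<Rightarrow> real ^ 2) \<Rightarrow> edge \<Rightarrow> real \<Rightarrow> complex" where
  "edge_path f d t = complex_of_plane (f (edge_point d t))"

definition vertex_pos :: "(real ^ vertex \<Rightarrow> real ^ 2) \<Rightarrow> vertex \<Rightarrow> complex" where
  "vertex_pos f v = complex_of_plane (f (axis v 1))"

lemma edge_path_ends:
  "edge_path f d 0 = vertex_pos f (fst d)" "edge_path f d 1 = vertex_pos f (snd d)"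
  by (simp_all add: edge_path_def vertex_pos_def edge_point_ends)

text \<open>Unlike for closed paths, this need not be an integer; its real part is the total change of the
  argument divided by \<open>2\<pi>\<close>.\<close>

definition turns :: "(real ^ vertex \<Rightarrow> real ^ 2) \<Rightarrow> vertex \<Rightarrow> edge \<Rightarrow> complex" where
  "turns f v d = winding_number (edge_path f d) (vertex_pos f v)"

lemma winding_number_scale:
  fixes p :: "real \<Rightarrow> complex"
  assumes "continuous_on {0..1} p" "\<And>t. t \<in> {0..1} \<Longrightarrow> p t \<noteq> 0" "c \<noteq> 0"
  shows "winding_number (\<lambda>t. c * p t) 0 = winding_number p 0"
  using winding_number_mult[of "\<lambda>t. c" p] winding_number_constI[of c 0 "\<lambda>t. c"] assms by simp

context
  fixes f :: "real ^ vertex \<Rightarrow> real ^ 2"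
  assumes gen: "plane_generic_immersion f"
begin

lemma continuous_on_edge_path:
  assumes "d \<in> edges"
  shows "continuous_on {0..1} (edge_path f d)"
proof -
  have "continuous_on HG f" using gen by (simp add: plane_generic_immersion_def plane_immersion_def)
  moreover have "continuous_on {0..1} (edge_point d)"
    unfolding edge_point_def[abs_def] by (intro continuous_intros)
  ultimately have "continuous_on {0..1} (\<lambda>t. f (edge_point d t))"
    by (rule continuous_on_compose2) (use edge_point_in_HG[OF assms] in auto)
  then show ?thesis
    unfolding edge_path_def[abs_def]
    by (rule bounded_linear.continuous_on[OF bounded_linear_complex_of_plane])
qed

lemma edge_path_neq_vertex_pos:
  assumes "d \<in> edges" "t \<in> {0..1}" "v \<notin> ends d"
  shows "edge_path f d t \<noteq> vertex_pos f v"
proof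
  assume "edge_path f d t = vertex_pos f v"
  then have "edge_point d t = axis v 1"
    using vertex_image_unique[OF gen edge_point_in_HG[OF assms(1,2)]]
    by (simp add: edge_path_def vertex_pos_def complex_of_plane_inject)
  then have "edge_point d t $ v \<noteq> 0" by simp
  then show False using edge_point_support_subset[of d t] assms(3) by auto
qed

lemma vertex_pos_inject: "vertex_pos f v = vertex_pos f w \<longleftrightarrow> v = w"
  using vertex_image_unique[OF gen axis_in_HG, of v w]
  by (auto simp: vertex_pos_def complex_of_plane_inject axis_eq_axis)

text \<open>On each side of the square one of the two points rests at a vertex, so the difference is
  an edge seen from that vertex.\<close>

lemma square_index_edges:
  assumes "d \<in> edges" "e \<in> edges" "ends d \<inter> ends e = {}"
  shows "square_index (\<lambda>z. edge_path f d (fst z) - edge_path f e (snd z)) =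
    turns f (fst e) d + turns f (snd d) e - turns f (snd e) d - turns f (fst d) e"
proof -
  have ne: "fst e \<notin> ends d" "snd e \<notin> ends d" "fst d \<notin> ends e" "snd d \<notin> ends e"
    using assms(3) by (auto simp: ends_def)
  \<comment> \<open>On the vertical sides the vertex is the minuend; the factor -1 does not affect
    the winding number.\<close>
  have neg: "winding_number (\<lambda>t. vertex_pos f v - edge_path f e t) 0 = turns f v e"
    if "v \<notin> ends e" for v
    using winding_number_scale[of "\<lambda>t. edge_path f e t - vertex_pos f v" "-1"] that
      edge_path_neq_vertex_pos[OF assms(2)] continuous_on_edge_path[OF assms(2)]
    by (simp add: turns_def winding_number_offset[of _ "vertex_pos f v"] continuous_on_diff)
  show ?thesis
    unfolding square_index_def fst_conv snd_conv edge_path_ends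
    by (simp add: neg ne) (simp add: turns_def winding_number_offset[of _ "vertex_pos f _"])
qed

text \<open>At a zero the derivative of the difference map is
  \<open>fst h *\<^sub>R v - snd h *\<^sub>R w\<close> for the two velocities, so transversality is
  the nondegeneracy required by \<open>square_index_parity\<close>.\<close>

lemma crossing_index:
  assumes de: "d \<in> edges" "e \<in> edges" "ends d \<inter> ends e = {}"
  shows "\<exists>m. turns f (fst e) d + turns f (snd d) e - turns f (snd e) d - turns f (fst d) e = of_int m
    \<and> even (m - int (card (common_points f {d, e})))"
proof -
  define F where "F z = edge_path f d (fst z) - edge_path f e (snd z)" for z
  define Z where "Z = {z \<in> {0..1} \<times> {0..1}. f (edge_point d (fst z)) = f (edge_point e (snd z))}"
  note bij = bij_betw_common_points[OF gen de, folded Z_def]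
  have Zeq: "Z = {z \<in> unit_square. F z = 0}"
    by (auto simp: Z_def F_def edge_path_def complex_of_plane_inject unit_square_def)
  have "\<exists>m. square_index F = of_int m \<and> even (m - int (card Z))"
  proof (rule square_index_parity)
    show "finite Z" using bij_betw_finite[OF bij] finite_common_points[OF gen de] by simp
    show "continuous_on unit_square F"
      unfolding F_def[abs_def] unit_square_def
      by (intro continuous_on_diff continuous_on_compose2[OF continuous_on_edge_path[OF de(1)]]
          continuous_on_compose2[OF continuous_on_edge_path[OF de(2)]] continuous_intros) auto
    show "Z = {z \<in> unit_square. F z = 0}" by (rule Zeq)
    have Z: "\<exists>v w. s \<in> {0<..<1} \<and> t \<in> {0<..<1} \<and> 
          (f \<circ> edge_point d has_vector_derivative v) (at s) \<and> (f \<circ> edge_point e has_vector_derivative w) (at t) \<and>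
          det (vector [v, w] :: real ^ 2 ^ 2) \<noteq> 0" if "(s, t) \<in> Z" for s t
      using crossing_of_disjoint_edges[OF gen de, of s t] that unfolding Z_def by simp metis
    show "Z \<subseteq> {0<..<1} \<times> {0<..<1}" using Z by fast
    fix z assume "z \<in> Z"
    then obtain s t v w where z: "z = (s, t)" and
      v: "(f \<circ> edge_point d has_vector_derivative v) (at s)" and
      w: "(f \<circ> edge_point e has_vector_derivative w) (at t)" and
      det: "det (vector [v, w] :: real ^ 2 ^ 2) \<noteq> 0"
      using Z by (cases z) blast
    have D: "(edge_path f d has_derivative (\<lambda>h. h *\<^sub>R complex_of_plane v)) (at s)"
      using bounded_linear.has_vector_derivative[OF bounded_linear_complex_of_plane v]
      by (simp add: edge_path_def[abs_def] has_vector_derivative_def o_def)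
    have E: "(edge_path f e has_derivative (\<lambda>h. h *\<^sub>R complex_of_plane w)) (at t)"
      using bounded_linear.has_vector_derivative[OF bounded_linear_complex_of_plane w]
      by (simp add: edge_path_def[abs_def] has_vector_derivative_def o_def)
    have "(fst has_derivative fst) (at (s, t) within unit_square)"
      "(snd has_derivative snd) (at (s, t) within unit_square)"
      by (auto intro!: derivative_eq_intros)
    from has_derivative_compose[OF this(1), unfolded fst_conv, OF D]
      has_derivative_compose[OF this(2), unfolded snd_conv, OF E]
    have "(F has_derivative (\<lambda>h. fst h *\<^sub>R complex_of_plane v - snd h *\<^sub>R complex_of_plane w))
        (at z within unit_square)"
      unfolding F_def[abs_def] z by (rule has_derivative_diff)
    then show "\<exists>p q. Im (cnj p * q) \<noteq> 0 \<and>
        (F has_derivative (\<lambda>h. fst h *\<^sub>R p - snd h *\<^sub>R q)) (at z within unit_square)"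
      using det unfolding det_vector_complex_of_plane by blast
  qed
  then show ?thesis
    using square_index_edges[OF de] bij_betw_same_card[OF bij] by (simp add: F_def[abs_def])
qed

section \<open>Directions between vertices and integer corrections\<close>

lemma common_points_parity:
  fixes R :: "vertex \<Rightarrow> vertex \<Rightarrow> bool"
  assumes R: "\<forall>v w. v \<noteq> w \<longrightarrow> (R v w \<longleftrightarrow> \<not> R w v)"
  shows "\<exists>n :: vertex \<Rightarrow> edge \<Rightarrow> int. \<forall>d\<in>edges. \<forall>e\<in>edges. ends d \<inter> ends e = {} \<longrightarrow>
    even (int (card (common_points f {d, e})) - (n (fst d) e + n (snd d) e + n (fst e) d + n (snd e) d
      + of_bool (R (fst d) (fst e)) + of_bool (R (fst d) (snd e))
      + of_bool (R (snd d) (fst e)) + of_bool (R (snd d) (snd e))))"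
proof -
  define P where "P = vertex_pos f"
  \<comment> \<open>A logarithm of the vector from \<open>v\<close> to \<open>w\<close>, divided by
    \<open>2 * pi * \<i>\<close>. Both directions of a pair use the same principal logarithm, chosen
    by \<open>R\<close>; the opposite one is shifted by a half turn.\<close>
  define \<kappa> where "\<kappa> v w = (if R v w then Ln (P w - P v) / (2 * of_real pi * \<i>)
    else Ln (P v - P w) / (2 * of_real pi * \<i>) + 1 / 2)" for v w
  have \<kappa>_exp: "exp (2 * of_real pi * \<i> * \<kappa> v w) = P w - P v" if "v \<noteq> w" for v w
  proof -
    have ne: "P w - P v \<noteq> 0" "P v - P w \<noteq> 0" using that vertex_pos_inject by (auto simp: P_def)
    have "2 * of_real pi * \<i> * \<kappa> v w
        = (if R v w then Ln (P w - P v) else Ln (P v - P w) + of_real pi * \<i>)"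
      by (simp add: \<kappa>_def distrib_left)
    then show ?thesis using ne by (simp add: exp_add)
  qed
  have \<kappa>_swap: "\<kappa> w v - \<kappa> v w = of_bool (R v w) - 1 / 2" if "v \<noteq> w" for v w
    using R[rule_format, OF that] by (simp add: \<kappa>_def)
  \<comment> \<open>Both sides without \<open>k\<close> exponentiate to the same quotient of end
    positions as seen from \<open>v\<close>, hence they differ by an integer.\<close>
  have "\<exists>k. turns f v d = \<kappa> v (snd d) - \<kappa> v (fst d) + of_int k" if d: "d \<in> edges" "v \<notin> ends d" for v d
  proof -
    have ne: "v \<noteq> fst d" "v \<noteq> snd d" using d by (auto simp: ends_def)
    have "P (snd d) - P v = exp (2 * of_real pi * \<i> * turns f v d) * (P (fst d) - P v)"
      using winding_number_exp_2pi[of "edge_path f d" "P v"] continuous_on_edge_path[OF d(1)]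
        edge_path_neq_vertex_pos[OF d(1) _ d(2)]
      by (force simp: path_def path_image_def pathfinish_def pathstart_def edge_path_ends turns_def P_def
          algebra_simps)
    then have "exp (2 * of_real pi * \<i> * \<kappa> v (snd d))
        = exp (2 * of_real pi * \<i> * (turns f v d + \<kappa> v (fst d)))"
      using \<kappa>_exp[OF ne(1)] \<kappa>_exp[OF ne(2)] by (simp add: distrib_left exp_add)
    then obtain n :: int where "2 * of_real pi * \<i> * \<kappa> v (snd d)
        = 2 * of_real pi * \<i> * (turns f v d + \<kappa> v (fst d)) + of_int (2 * n) * of_real pi * \<i>"
      unfolding exp_eq by (auto simp: mult_ac)
    then have "2 * of_real pi * \<i> * \<kappa> v (snd d) = 2 * of_real pi * \<i> * (turns f v d + \<kappa> v (fst d) + of_int n)"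
      by (simp add: algebra_simps)
    then have "\<kappa> v (snd d) = turns f v d + \<kappa> v (fst d) + of_int n"
      by simp
    then show ?thesis by (intro exI[of _ "- n"]) simp
  qed
  then have "\<forall>v d. \<exists>k. d \<in> edges \<longrightarrow> v \<notin> ends d \<longrightarrow>
      turns f v d = \<kappa> v (snd d) - \<kappa> v (fst d) + of_int k" by blast
  \<comment> \<open>The integer depends only on the vertex and the edge, so it is shared by all
    pairs formed with the edges at \<open>v\<close>; the later cancellation rests on this.\<close>
  then obtain n where n: "\<And>v d. d \<in> edges \<Longrightarrow> v \<notin> ends d \<Longrightarrow>
      turns f v d = \<kappa> v (snd d) - \<kappa> v (fst d) + of_int (n v d)"
    unfolding choice_iff by blast
  show ?thesis
  proof (intro exI[of _ n] ballI impI)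
    fix d e assume de: "d \<in> edges" "e \<in> edges" "ends d \<inter> ends e = {}"
    obtain a b where d: "d = (a, b)" by (cases d)
    obtain x y where e: "e = (x, y)" by (cases e)
    have ne: "a \<noteq> x" "a \<noteq> y" "b \<noteq> x" "b \<noteq> y" using de(3) by (auto simp: d e ends_def)
    obtain m where m: "turns f x d + turns f b e - turns f y d - turns f a e = of_int m"
      "even (m - int (card (common_points f {d, e})))"
      using crossing_index[OF de] by (auto simp: d e)
    have t: "turns f x d = \<kappa> x b - \<kappa> x a + of_int (n x d)" "turns f b e = \<kappa> b y - \<kappa> b x + of_int (n b e)"
      "turns f y d = \<kappa> y b - \<kappa> y a + of_int (n y d)" "turns f a e = \<kappa> a y - \<kappa> a x + of_int (n a e)"
      using n[of d x] n[of d y] n[of e a] n[of e b] de ne by (auto simp: d e ends_def)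
    \<comment> \<open>Grouped by pairs of vertices, the directions form four swap differences with
      signs +, -, -, +, so that the halves in \<open>\<kappa>_swap\<close> cancel.\<close>
    have "(of_int m :: complex) = (\<kappa> x b - \<kappa> b x) - (\<kappa> x a - \<kappa> a x) - (\<kappa> y b - \<kappa> b y) + (\<kappa> y a - \<kappa> a y)
        + of_int (n x d + n b e - n y d - n a e)"
      unfolding m(1)[symmetric] t by simp
    also have "\<dots> = of_int (of_bool (R b x) - of_bool (R a x) - of_bool (R b y) + of_bool (R a y)
        + (n x d + n b e - n y d - n a e))"
      unfolding \<kappa>_swap[OF ne(1)] \<kappa>_swap[OF ne(2)] \<kappa>_swap[OF ne(3)] \<kappa>_swap[OF ne(4)] by simp
    finally have "m = of_bool (R b x) - of_bool (R a x) - of_bool (R b y) + of_bool (R a y)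
        + (n x d + n b e - n y d - n a e)"
      unfolding of_int_eq_iff .
    then have "int (card (common_points f {d, e})) - (n (fst d) e + n (snd d) e + n (fst e) d
      + n (snd e) d + of_bool (R (fst d) (fst e)) + of_bool (R (fst d) (snd e))
      + of_bool (R (snd d) (fst e)) + of_bool (R (snd d) (snd e)))
      = - (m - int (card (common_points f {d, e})))
        - 2 * (of_bool (R a x) + of_bool (R b y) + n y d + n a e)"
      by (simp add: d e)
    then show "even (int (card (common_points f {d, e})) - (n (fst d) e + n (snd d) e + n (fst e) d
      + n (snd e) d + of_bool (R (fst d) (fst e)) + of_bool (R (fst d) (snd e))
      + of_bool (R (snd d) (fst e)) + of_bool (R (snd d) (snd e))))"
      using m(2) by (simp only: dvd_diff dvd_minus_iff dvd_triv_left)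
  qed
qed

end

section \<open>Pairs of edges at distance two\<close>

lemma edge_dist_eqI:
  assumes "\<exists>xs. graph_path xs \<and> hd xs \<in> ends d \<and> last xs \<in> ends e \<and> length xs = Suc n"
    and "\<And>xs. graph_path xs \<Longrightarrow> hd xs \<in> ends d \<Longrightarrow> last xs \<in> ends e \<Longrightarrow> n < length xs"
  shows "edge_dist d e = n"
  unfolding edge_dist_def
proof (rule Least_equality)
  show "\<exists>xs. graph_path xs \<and> hd xs \<in> ends d \<and> last xs \<in> ends e \<and> n = length xs - 1"
    using assms(1) by force
qed (use assms(2) in fastforce)

lemma edge_dist_0:
  assumes "ends d \<inter> ends e \<noteq> {}"
  shows "edge_dist d e = 0"
proof (rule edge_dist_eqI)
  obtain x where "x \<in> ends d" "x \<in> ends e" using assms by blast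
  then show "\<exists>xs. graph_path xs \<and> hd xs \<in> ends d \<and> last xs \<in> ends e \<and> length xs = Suc 0"
    by (intro exI[of _ "[x]"]) (simp add: graph_path_def)
qed (auto simp: graph_path_def)

lemma two_le_graph_path:
  assumes "ends d \<inter> ends e = {}" "graph_path xs" "hd xs \<in> ends d" "last xs \<in> ends e"
  shows "1 < length xs"
proof (rule ccontr)
  assume "\<not> 1 < length xs"
  then obtain x where "xs = [x]"
    using assms(2) by (cases xs) (auto simp: graph_path_def)
  then show False using assms by auto
qed

lemma edge_dist_1:
  assumes "ends d \<inter> ends e = {}" "x \<in> ends d" "y \<in> ends e" "adjacent x y"
  shows "edge_dist d e = 1"
proof (rule edge_dist_eqI)
  show "\<exists>xs. graph_path xs \<and> hd xs \<in> ends d \<and> last xs \<in> ends e \<and> length xs = Suc 1"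
    using assms by (intro exI[of _ "[x, y]"]) (auto simp: graph_path_def)
qed (use two_le_graph_path[OF assms(1)] in auto)

text \<open>The Heawood graph is the incidence graph of the Fano plane: any two points lie on a line.\<close>

lemma common_neighbour: "\<exists>j. adjacent (U a) (V j) \<and> adjacent (V j) (U b)"
proof -
  \<comment> \<open>The set {0, -1, 2} is a perfect difference set modulo 7: every nonzero residue
    is a difference of two of its elements.\<close>
  have "\<exists>j\<in>{a, a - 1, a + 2}. j \<in> {b, b - 1, b + 2}"
    by (rule seven_cases[of b a]; auto simp: minus_seven add.assoc)
  then show ?thesis by (auto simp: adjacent_simps)
qed

text \<open>Excludes distances 0 and 1 explicitly; no two edges have a greater distance than 2, so
  this describes distance 2.\<close>

definition far :: "edge \<Rightarrow> edge \<Rightarrow> bool" where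
  "far d e \<longleftrightarrow> ends d \<inter> ends e = {} \<and> (\<forall>x\<in>ends d. \<forall>y\<in>ends e. \<not> adjacent x y)"

lemma adjacent_sym: "adjacent x y \<longleftrightarrow> adjacent y x"
  by (auto simp: adjacent_def)

lemma far_sym: "far d e \<longleftrightarrow> far e d"
  unfolding far_def by (metis Int_commute adjacent_sym)

lemma U_end: "d \<in> edges \<Longrightarrow> \<exists>i. U i \<in> ends d"
  by (auto simp: edges_def ends_def)

text \<open>Each edge has an end of type \<open>U\<close>, and two such ends have a common
  neighbour, which gives a path with two edges; shorter paths are excluded by
  \<open>far\<close>.\<close>

lemma edge_dist_2:
  assumes "d \<in> edges" "e \<in> edges" "far d e"
  shows "edge_dist d e = 2"
proof (rule edge_dist_eqI)
  have disj: "ends d \<inter> ends e = {}" using assms(3) by (simp add: far_def)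
  obtain a b where ab: "U a \<in> ends d" "U b \<in> ends e" using U_end assms by blast
  moreover from this have "a \<noteq> b" using disj by blast
  moreover obtain j where "adjacent (U a) (V j)" "adjacent (V j) (U b)" using common_neighbour by blast
  ultimately show "\<exists>xs. graph_path xs \<and> hd xs \<in> ends d \<and> last xs \<in> ends e \<and> length xs = Suc 2"
    by (intro exI[of _ "[U a, V j, U b]"]) (simp add: graph_path_def)
  fix xs assume xs: "graph_path xs" "hd xs \<in> ends d" "last xs \<in> ends e"
  show "2 < length xs"
  proof (rule ccontr)
    assume "\<not> 2 < length xs"
    then have "length xs = Suc (Suc 0)" using two_le_graph_path[OF disj xs] by simp
    then obtain x y where "xs = [x, y]" by (auto simp: length_Suc_conv)
    then show False using xs assms(3) by (auto simp: graph_path_def far_def)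
  qed
qed

lemma edge_dist_cases:
  assumes "d \<in> edges" "e \<in> edges"
  shows "edge_dist d e = (if ends d \<inter> ends e \<noteq> {} then 0 else if far d e then 2 else 1)"
  using edge_dist_0[of d e] edge_dist_1[of d e] edge_dist_2[OF assms] unfolding far_def by auto

lemma edge_pairs_1_iff:
  "{d, e} \<in> edge_pairs 1 \<longleftrightarrow> d \<in> edges \<and> e \<in> edges \<and> ends d \<inter> ends e = {} \<and> \<not> far d e"
proof
  assume "{d, e} \<in> edge_pairs 1"
  then obtain d' e' where "{d, e} = {d', e'}" and *: "d' \<in> edges" "e' \<in> edges" "edge_dist d' e' = 1"
    unfolding edge_pairs_def by blast
  then have "d = d' \<and> e = e' \<or> d = e' \<and> e = d'" by (simp add: doubleton_eq_iff)
  moreover have "ends d' \<inter> ends e' = {}" "\<not> far d' e'"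
    using edge_dist_cases[OF *(1,2)] unfolding *(3) by (simp_all split: if_splits)
  ultimately show "d \<in> edges \<and> e \<in> edges \<and> ends d \<inter> ends e = {} \<and> \<not> far d e"
    using * far_sym[of d' e'] by auto
next
  assume *: "d \<in> edges \<and> e \<in> edges \<and> ends d \<inter> ends e = {} \<and> \<not> far d e"
  then have "edge_dist d e = 1" using edge_dist_cases[of d e] by simp
  moreover have "d \<noteq> e" using * by (auto simp: ends_def)
  ultimately show "{d, e} \<in> edge_pairs 1" using * unfolding edge_pairs_def by blast
qed

lemma edge_pairs_2_iff: "{d, e} \<in> edge_pairs 2 \<longleftrightarrow> d \<in> edges \<and> e \<in> edges \<and> far d e"
proof
  assume "{d, e} \<in> edge_pairs 2"
  then obtain d' e' where "{d, e} = {d', e'}" and *: "d' \<in> edges" "e' \<in> edges" "edge_dist d' e' = 2"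
    unfolding edge_pairs_def by blast
  then have "d = d' \<and> e = e' \<or> d = e' \<and> e = d'" by (simp add: doubleton_eq_iff)
  moreover have "far d' e'"
    using * edge_dist_cases[OF *(1,2)] by (auto split: if_splits)
  ultimately show "d \<in> edges \<and> e \<in> edges \<and> far d e"
    using * far_sym[of d' e'] by auto
next
  assume *: "d \<in> edges \<and> e \<in> edges \<and> far d e"
  then have "edge_dist d e = 2" using edge_dist_2 by simp
  moreover have "d \<noteq> e" using * by (auto simp: ends_def far_def)
  ultimately show "{d, e} \<in> edge_pairs 2" using * unfolding edge_pairs_def by blast
qed

lemma finite_edge_pairs: "finite (edge_pairs k)"
  by (rule finite_subset[of _ UNIV]) auto

section \<open>Rotation orbits of pairs of edges\<close>

definition std_edge :: "nat \<Rightarrow> 7 \<Rightarrow> edge" where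
  "std_edge x i = (if x = 0 then (U i, V i) else if x = 1 then (U i, V (i - 1)) else (V i, U (i - 2)))"

lemma edges_eq: "edges = (\<Union>x\<in>{0, 1, 2}. range (std_edge x))"
  by (auto simp: edges_def std_edge_def image_iff)

lemma std_edge_inject:
  "x \<in> {0, 1, 2} \<Longrightarrow> y \<in> {0, 1, 2} \<Longrightarrow> std_edge x i = std_edge y j \<longleftrightarrow> x = y \<and> i = j"
  by (auto simp: std_edge_def)

text \<open>One pair \<open>{std_edge x i, std_edge y (i + k)}\<close> for each orbit of pairs at distance 2 under
  the rotation \<open>i \<mapsto> i + 1\<close>.\<close>

definition far_reps :: "(nat \<times> nat \<times> 7) set" where
  "far_reps = {(0, 0, 3), (0, 1, 2), (0, 1, 4), (0, 1, 6), (0, 2, 1), (0, 2, 4), (0, 2, 5),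
    (1, 1, 2), (1, 2, 3), (1, 2, 4), (1, 2, 5), (2, 2, 1)}"

text \<open>A finite check over the shifts. The ordering of the classes selects one order of each
  unordered pair; within a class the shifts \<open>k\<close> and \<open>- k\<close> give the same
  orbit, whence 1, 2, 3.\<close>

lemma far_std_edge:
  assumes "x \<in> {0, 1, 2}" "y \<in> {0, 1, 2}" "x < y \<or> x = y \<and> k \<in> {1, 2, 3}"
  shows "far (std_edge x i) (std_edge y (i + k)) \<longleftrightarrow> (x, y, k) \<in> far_reps"
proof -
  note far_simps = far_def far_reps_def std_edge_def ends_def adjacent_simps minus_seven add.assoc
  consider "x = 0" "y = 1" | "x = 0" "y = 2" | "x = 1" "y = 2" | "y = x" "k = 1" | "y = x" "k = 2" | "y = x" "k = 3"
    using assms by auto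
  then show ?thesis
  proof cases
    case 1 then show ?thesis by (rule_tac seven_cases[of k 0]) (simp_all add: far_simps)
  next
    case 2 then show ?thesis by (rule_tac seven_cases[of k 0]) (simp_all add: far_simps)
  next
    case 3 then show ?thesis by (rule_tac seven_cases[of k 0]) (simp_all add: far_simps)
  next
    case 4 then show ?thesis using assms(1) by (elim insertE emptyE) (simp_all add: far_simps)
  next
    case 5 then show ?thesis using assms(1) by (elim insertE emptyE) (simp_all add: far_simps)
  next
    case 6 then show ?thesis using assms(1) by (elim insertE emptyE) (simp_all add: far_simps)
  qed
qed

lemma bij_betw_far_reps:
  "bij_betw (\<lambda>((x, y, k), i). {std_edge x i, std_edge y (i + k)}) (far_reps \<times> UNIV) (edge_pairs 2)"
proof (rule bij_betw_imageI)
  have range: "x \<in> {0, 1, 2} \<and> y \<in> {0, 1, 2} \<and> (x < y \<or> x = y \<and> k \<in> {1, 2, 3})"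
    if "(x, y, k) \<in> far_reps" for x y k
    using that by (auto simp: far_reps_def)
  show "inj_on (\<lambda>((x, y, k), i). {std_edge x i, std_edge y (i + k)}) (far_reps \<times> UNIV)"
  proof (rule inj_onI, clarify)
    fix x y k i x' y' k' i'
    assume r: "(x, y, k) \<in> far_reps" "(x', y', k') \<in> far_reps"
      and eq: "{std_edge x i, std_edge y (i + k)} = {std_edge x' i', std_edge y' (i' + k')}"
    note xy = range[OF r(1)] range[OF r(2)]
    from xy eq have "x = x' \<and> i = i' \<and> y = y' \<and> i + k = i' + k'
        \<or> x = y' \<and> i = i' + k' \<and> y = x' \<and> i + k = i'"
      unfolding doubleton_eq_iff by (simp add: std_edge_inject)
    then show "(x, y, k) = (x', y', k') \<and> i = i'"
    proof
      \<comment> \<open>Exchanged edges force all of them into one class and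
        \<open>k' = - k\<close>, but no two elements of {1, 2, 3} add up to 0 modulo 7.\<close>
      assume *: "x = y' \<and> i = i' + k' \<and> y = x' \<and> i + k = i'"
      then have "i + (k + k') = i" by (metis add.assoc)
      then have k: "k + k' = 0" by simp
      have "k \<in> {1, 2, 3}" "k' \<in> {1, 2, 3}" using xy * by linarith+
      then show ?thesis using k by (elim insertE emptyE) simp_all
    qed auto
  qed
  show "(\<lambda>((x, y, k), i). {std_edge x i, std_edge y (i + k)}) ` (far_reps \<times> UNIV) = edge_pairs 2"
  proof (intro equalityI subsetI)
    fix p assume "p \<in> (\<lambda>((x, y, k), i). {std_edge x i, std_edge y (i + k)}) ` (far_reps \<times> UNIV)"
    then obtain x y k i where p: "p = {std_edge x i, std_edge y (i + k)}" and r: "(x, y, k) \<in> far_reps"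
      by auto
    then show "p \<in> edge_pairs 2"
      using far_std_edge[of x y k i] range[OF r] by (auto simp: edge_pairs_2_iff edges_eq)
  next
    fix p assume "p \<in> edge_pairs 2"
    then obtain d e where p: "p = {d, e}" unfolding edge_pairs_def by blast
    then have "d \<in> edges" "e \<in> edges" "far d e" using \<open>p \<in> edge_pairs 2\<close> edge_pairs_2_iff by auto
    then obtain x y i j where d: "d = std_edge x i" "x \<in> {0, 1, 2}" and e: "e = std_edge y j" "y \<in> {0, 1, 2}"
      unfolding edges_eq by blast
    have "d \<noteq> e" using \<open>far d e\<close> by (auto simp: far_def ends_def)
    have dir: "p \<in> (\<lambda>((x, y, k), i). {std_edge x i, std_edge y (i + k)}) ` (far_reps \<times> UNIV)"
      if "p = {std_edge x i, std_edge y j}" "far (std_edge x i) (std_edge y j)"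
        "x \<in> {0, 1, 2}" "y \<in> {0, 1, 2}" "x < y \<or> x = y \<and> j - i \<in> {1, 2, 3}" for x y i j
    proof (rule image_eqI)
      show "p = (\<lambda>((x, y, k), i). {std_edge x i, std_edge y (i + k)}) ((x, y, j - i), i)" using that by simp
      show "((x, y, j - i), i) \<in> far_reps \<times> UNIV" using far_std_edge[of x y "j - i" i] that by simp
    qed
    \<comment> \<open>Of a nonzero residue and its negative one lies in {1, 2, 3}, so
      \<open>dir\<close> applies after exchanging the edges if necessary.\<close>
    have "j - i \<in> {1, 2, 3} \<or> i - j \<in> {1, 2, 3}" if "i \<noteq> j"
      by (rule seven_cases[of j i]) (use that in auto)
    then consider "x < y \<or> x = y \<and> j - i \<in> {1, 2, 3}" | "y < x \<or> y = x \<and> i - j \<in> {1, 2, 3}"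
      using \<open>d \<noteq> e\<close> d e by (metis linorder_neqE_nat)
    then show "p \<in> (\<lambda>((x, y, k), i). {std_edge x i, std_edge y (i + k)}) ` (far_reps \<times> UNIV)"
      using dir[of x i y j] dir[of y j x i] \<open>far d e\<close> far_sym p d e by cases (auto simp: insert_commute)
  qed
qed

lemma sum_edge_pairs_2:
  "(\<Sum>p\<in>edge_pairs 2. h p) = (\<Sum>(x, y, k)\<in>far_reps. \<Sum>i\<in>UNIV. h {std_edge x i, std_edge y (i + k)})"
  unfolding sum.reindex_bij_betw[OF bij_betw_far_reps, symmetric]
  by (simp add: sum.cartesian_product case_prod_unfold)

section \<open>Parity of the coefficients\<close>

lemma eps_table_odd:
  assumes "(d, e, k) \<in> eps_table"
  shows "odd k \<longleftrightarrow> far d e"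
  using assms unfolding eps_table_def UN_iff
  by (elim bexE) (simp only: insert_iff empty_iff prod.inject, elim disjE conjE;
    simp add: far_def ends_def adjacent_simps minus_seven add.assoc)

lemma eps_odd:
  assumes "d \<in> edges" "e \<in> edges" "ends d \<inter> ends e = {}"
  shows "odd (eps {d, e}) \<longleftrightarrow> far d e"
proof -
  obtain k where "(d, e, k) \<in> eps_table \<or> (e, d, k) \<in> eps_table"
    using eps_table_covers[OF assms] by blast
  then show ?thesis
  proof
    assume "(d, e, k) \<in> eps_table"
    then show ?thesis by (simp only: eps_eq eps_table_odd)
  next
    \<comment> \<open>The table lists each pair of different classes in one order only; both
      \<open>eps\<close> and \<open>far\<close> are symmetric.\<close>
    assume k: "(e, d, k) \<in> eps_table"
    show ?thesis unfolding insert_commute[of d] eps_eq[OF k] eps_table_odd[OF k] by (rule far_sym)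
  qed
qed

text \<open>A tournament invariant under rotation: 1, 2, 4 are the quadratic residues modulo 7, and -1 is
  not a residue.\<close>

fun beats :: "vertex \<Rightarrow> vertex \<Rightarrow> bool" where
  "beats (U i) (U j) \<longleftrightarrow> j - i \<in> {1, 2, 4}"
| "beats (V i) (V j) \<longleftrightarrow> j - i \<in> {1, 2, 4}"
| "beats (U i) (V j) \<longleftrightarrow> True"
| "beats (V i) (U j) \<longleftrightarrow> False"

lemma minus_numeral_seven:
  "(- 1 :: 7) = 6" "(- 2 :: 7) = 5" "(- 3 :: 7) = 4" "(- 4 :: 7) = 3" "(- 5 :: 7) = 2" "(- 6 :: 7) = 1"
  "(7 :: 7) = 0" "(8 :: 7) = 1" "(9 :: 7) = 2" "(10 :: 7) = 3" "(11 :: 7) = 4" "(12 :: 7) = 5" "(13 :: 7) = 6"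
  by simp_all

lemma beats_asym:
  "\<forall>v w. v \<noteq> w \<longrightarrow> (beats v w \<longleftrightarrow> \<not> beats w v)"
proof (intro allI impI)
  fix v w :: vertex assume ne: "v \<noteq> w"
  have "j - i \<in> {1, 2, 4} \<longleftrightarrow> i - j \<notin> {1, 2, 4}" if "i \<noteq> j" for i j :: 7
    by (rule seven_cases[of j i]) (use that in \<open>auto simp: minus_numeral_seven\<close>)
  note D = this
  show "beats v w \<longleftrightarrow> \<not> beats w v"
  proof (cases v)
    case (U i)
    then show ?thesis using ne D[of i] by (cases w) (simp_all only: beats.simps vertex.inject simp_thms)
  next
    case (V i)
    then show ?thesis using ne D[of i] by (cases w) (simp_all only: beats.simps vertex.inject simp_thms)
  qed
qed

lemma sum_shift_7:
  fixes g :: "7 \<Rightarrow> 7 \<Rightarrow> int"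
  shows "(\<Sum>i\<in>UNIV. g (i + a) (i + b)) = (\<Sum>i\<in>UNIV. g i (i + (b - a)))"
  by (rule sum.reindex_bij_witness[of _ "\<lambda>i. i - a" "\<lambda>i. i + a"]) (simp_all add: algebra_simps)

text \<open>Let \<open>v\<close> be neither on \<open>d\<close> nor adjacent to an end of
  \<open>d\<close>. It has exactly one common neighbour with the end of \<open>d\<close> of its own
  type, so exactly two of the three edges at \<open>v\<close> are far from \<open>d\<close>; for
  every other \<open>v\<close> there are none. Hence each \<open>n v d\<close> occurs twice or
  never.\<close>

lemma sum_far_parity:
  fixes n :: "vertex \<Rightarrow> edge \<Rightarrow> int"
  defines "T d e \<equiv> n (fst d) e + n (snd d) e + n (fst e) d + n (snd e) d
      + of_bool (beats (fst d) (fst e)) + of_bool (beats (fst d) (snd e))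
      + of_bool (beats (snd d) (fst e)) + of_bool (beats (snd d) (snd e))"
  shows "odd (\<Sum>(x, y, k)\<in>far_reps. \<Sum>i\<in>UNIV. T (std_edge x i) (std_edge y (i + k)))"
proof -
  define N where "N v x m = (\<Sum>i\<in>UNIV. n (v i) (std_edge x (i + m)))" for v :: "7 \<Rightarrow> vertex" and x m
  have N: "(\<Sum>i\<in>UNIV. n (v (i + a)) (std_edge x (i + b))) = N v x (b - a)"
    "(\<Sum>i\<in>UNIV. n (v i) (std_edge x (i + b))) = N v x b"
    "(\<Sum>i\<in>UNIV. n (v (i + a)) (std_edge x i)) = N v x (- a)"
    "(\<Sum>i\<in>UNIV. n (v i) (std_edge x i)) = N v x 0" for v x a b
    using sum_shift_7[of "\<lambda>i j. n (v i) (std_edge x j)" a b]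
      sum_shift_7[of "\<lambda>i j. n (v i) (std_edge x j)" a 0]
    by (simp_all add: N_def)
  have ends: "fst (std_edge 0 i) = U i" "snd (std_edge 0 i) = V i"
    "fst (std_edge (Suc 0) i) = U i" "snd (std_edge (Suc 0) i) = V (i + 6)"
    "fst (std_edge 2 i) = V i" "snd (std_edge 2 i) = U (i + 5)" for i
    by (simp_all add: std_edge_def minus_seven)
  \<comment> \<open>The terms \<open>N\<close> are sums of \<open>n\<close> over rotation orbits of
    vertex-edge pairs. The constant is 7 * 25: in the 12 representatives 25 of the 48 comparisons
    hold, and each is repeated by the 7 rotations.\<close>
  have "(\<Sum>(x, y, k)\<in>far_reps. \<Sum>i\<in>UNIV. T (std_edge x i) (std_edge y (i + k)))
    = 2 * (N U 0 1 + N U 0 3 + N U 0 4 + N U 0 5 + N U 1 2 + N U 1 4 + N U 1 5 + N U 1 6 + N U 2 1 +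
      N U 2 3 + N U 2 4 + N U 2 5 + N V 0 2 + N V 0 3 + N V 0 4 + N V 0 6 + N V 1 2 + N V 1 3 +
      N V 1 4 + N V 1 6 + N V 2 1 + N V 2 4 + N V 2 5 + N V 2 6) + 175"
    unfolding far_reps_def T_def
    by (simp add: ends sum.distrib N[of U] N[of V] add.assoc minus_numeral_seven)
  then show ?thesis by simp
qed

lemma odd_sum_common_points:
  assumes "plane_generic_immersion f"
  shows "odd (\<Sum>p\<in>edge_pairs 2. int (card (common_points f p)))"
proof -
  obtain n :: "vertex \<Rightarrow> edge \<Rightarrow> int" where n: "\<forall>d\<in>edges. \<forall>e\<in>edges. ends d \<inter> ends e = {} \<longrightarrow>
    even (int (card (common_points f {d, e})) - (n (fst d) e + n (snd d) e + n (fst e) d + n (snd e) d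
      + of_bool (beats (fst d) (fst e)) + of_bool (beats (fst d) (snd e))
      + of_bool (beats (snd d) (fst e)) + of_bool (beats (snd d) (snd e))))"
    using common_points_parity[OF assms beats_asym] by (elim exE)
  define T where "T d e = n (fst d) e + n (snd d) e + n (fst e) d + n (snd e) d
      + of_bool (beats (fst d) (fst e)) + of_bool (beats (fst d) (snd e))
      + of_bool (beats (snd d) (fst e)) + of_bool (beats (snd d) (snd e))" for d e
  have "even (int (card (common_points f {d, e})) - T d e)" if "{d, e} \<in> edge_pairs 2" for d e
    unfolding T_def by (rule n[rule_format]) (use that in \<open>auto simp: edge_pairs_2_iff far_def\<close>)
  moreover have "{std_edge x i, std_edge y (i + k)} \<in> edge_pairs 2" if "(x, y, k) \<in> far_reps" for x y k i
    using bij_betwE[OF bij_betw_far_reps] that by force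
  ultimately have "even ((\<Sum>(x, y, k)\<in>far_reps. \<Sum>i\<in>UNIV.
        int (card (common_points f {std_edge x i, std_edge y (i + k)})))
      - (\<Sum>(x, y, k)\<in>far_reps. \<Sum>i\<in>UNIV. T (std_edge x i) (std_edge y (i + k))))"
    unfolding case_prod_unfold sum_subtractf[symmetric] by (intro dvd_sum) auto
  moreover have "odd (\<Sum>(x, y, k)\<in>far_reps. \<Sum>i\<in>UNIV. T (std_edge x i) (std_edge y (i + k)))"
    unfolding T_def by (rule sum_far_parity)
  ultimately show ?thesis unfolding sum_edge_pairs_2 by simp
qed

theorem theorem1p8:
  fixes f :: "real ^ vertex \<Rightarrow> real ^ 2" and \<phi> :: "real ^ vertex \<Rightarrow> real ^ 3"
  assumes "plane_generic_immersion f"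
    and "spatial_embedding \<phi>"
    and "is_lift \<phi> f"
  shows "[L_inv f \<phi> = (\<Sum>p\<in>edge_pairs 2. int (card (common_points f p)))] (mod 2) \<and>
         [(\<Sum>p\<in>edge_pairs 2. int (card (common_points f p))) = 1] (mod 2)"
proof
  have pair: "\<exists>d e. p = {d, e}" if "p \<in> edge_pairs k" for p k
    using that by (auto simp: edge_pairs_def)
  have "edge_pairs 1 \<inter> edge_pairs 2 = {}"
    using pair edge_pairs_1_iff edge_pairs_2_iff by (metis disjoint_iff)
  then have L: "L_inv f \<phi> = (\<Sum>p\<in>edge_pairs 1. eps p * ell f \<phi> p) + (\<Sum>p\<in>edge_pairs 2. eps p * ell f \<phi> p)"
    unfolding L_inv_def by (intro sum.union_disjoint finite_edge_pairs)
  \<comment> \<open>At distance 1 the coefficient is even, so these pairs vanish modulo 2.\<close>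
  have "even (\<Sum>p\<in>edge_pairs 1. eps p * ell f \<phi> p)"
  proof (rule dvd_sum)
    fix p assume p: "p \<in> edge_pairs 1"
    then obtain d e where "p = {d, e}" using pair by blast
    then show "even (eps p * ell f \<phi> p)" using p eps_odd[of d e] by (simp add: edge_pairs_1_iff[simplified])
  qed
  \<comment> \<open>At distance 2 the coefficient is odd, and the signed count has the parity of the
    number of crossings.\<close>
  moreover have "even (\<Sum>p\<in>edge_pairs 2. eps p * ell f \<phi> p - int (card (common_points f p)))"
  proof (rule dvd_sum)
    fix p assume p: "p \<in> edge_pairs 2"
    then obtain d e where de: "p = {d, e}" using pair by blast
    then have *: "d \<in> edges" "e \<in> edges" "far d e" "ends d \<inter> ends e = {}"
      using p by (auto simp: edge_pairs_2_iff far_def)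
    then show "even (eps p * ell f \<phi> p - int (card (common_points f p)))"
      using eps_odd[OF *(1,2,4)] ell_parity[OF assms *(1,2,4)] unfolding de by simp
  qed
  ultimately show "[L_inv f \<phi> = (\<Sum>p\<in>edge_pairs 2. int (card (common_points f p)))] (mod 2)"
    unfolding L cong_iff_dvd_diff sum_subtractf add_diff_eq[symmetric] by simp
  show "[(\<Sum>p\<in>edge_pairs 2. int (card (common_points f p))) = 1] (mod 2)"
    using odd_sum_common_points[OF assms(1)] by (simp add: cong_iff_dvd_diff)
qed

end
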